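(* Suppose that for each line $(i,j)\in\mathcal{E}$ the series admittance matrix is symmetric ($\mathbf{y}_{ij}=\mathbf{y}_{ij}^{\sf T}$) and the conductance matrix $\mathbf{g}_{ij}=\mathrm{Re}\{\mathbf{y}_{ij}\}$ is strictly diagonally dominant (by rows). Then there is a threshold $\beta_0>0$, depending only on the line admittances and the topology of the network, such that for every $\beta\in(0,\beta_0]$ and every $\mathbf{u}\in\mathbb{R}^{3U}$, every optimal solution $(\mathbf{W}^{\rm opt},z^{\rm opt})$ of the SDP PE$(\mathbf{u})$ satisfies $\mathrm{rank}(\mathbf{W}^{\rm opt})=1$ and recovers a vector of nodal voltages, i.e. $\mathbf{W}^{\rm opt}=\mathbf{V}\mathbf{V}^{\sf H}$ for some $\mathbf{V}\in\mathbb{C}^{3(N+1)}$ whose first three entries form $\mathbf{V}_{\rm ref}$.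
   Context: Network. Let $N\ge 1$ and let $\mathcal{G}=(\mathcal{V},\mathcal{E})$ be a tree on the buses $\mathcal{V}=\{0,1,\dots,N\}$; bus $0$ is the slack (root) bus and $\mathcal{N}^+=\{1,\dots,N\}$. Write $j\sim k$ if $(j,k)\in\mathcal{E}$. Phases $\phi\in\{a,b,c\}$ are identified with $1,2,3$. Each line $(j,k)$ has a series admittance matrix $\mathbf{y}_{jk}=\mathbf{y}_{kj}\in\mathbb{C}^{3\times3}$. For a $3(N+1)\times 3(N+1)$ matrix $\mathbf{X}$, $[\mathbf{X}]_{jk}$ is the $3\times3$ block with rows $3j+1,\dots,3j+3$ and columns $3k+1,\dots,3k+3$. The admittance matrix $\mathbf{Y}\in\mathbb{C}^{3(N+1)\times3(N+1)}$ has blocks $[\mathbf{Y}]_{jj}=\sum_{k:k\sim j}\mathbf{y}_{jk}$, $[\mathbf{Y}]_{jk}=-\mathbf{y}_{jk}$ if $j\sim k$, and $[\mathbf{Y}]_{jk}=0$ if $j\ne k$, $j\nsim k$. Let $\mathbf{e}_j^\phi\in\mathbb{R}^{3(N+1)}$ be the standard basis vector with $1$ in entry $3j+\phi$, $\mathbf{E}_j^\phi=\mathbf{e}_j^\phi(\mathbf{e}_j^\phi)^{\sf T}$, $\mathbf{Y}_j^\phi=\mathbf{E}_j^\phi\mathbf{Y}$, $\bm{\mathcal{P}}_j^\phi=\frac12((\mathbf{Y}_j^\phi)^{\sf H}+\mathbf{Y}_j^\phi)$, $\bm{\mathcal{Q}}_j^\phi=\frac1{2i}((\mathbf{Y}_j^\phi)^{\sf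 H}-\mathbf{Y}_j^\phi)$ (with $i$ the imaginary unit), and $\mathbf{C}=\frac12(\mathbf{Y}+\mathbf{Y}^{\sf H})$, so that $\mathrm{tr}(\mathbf{C}\mathbf{W})$ is the active power loss. Data. Given real constants $\underline{p}_j^\phi\le\overline{p}_j^\phi$, $\underline{q}_j^\phi\le\overline{q}_j^\phi$, $0\le\underline{V}_j^\phi\le\overline{V}_j^\phi$ for $j\in\mathcal{N}^+$ and each $\phi$, put $\underline{v}_j^\phi=(\underline{V}_j^\phi)^2$, $\overline{v}_j^\phi=(\overline{V}_j^\phi)^2$. The slack voltage $\mathbf{V}_{\rm ref}\in\mathbb{C}^3$ is fixed and nonzero, and $\bm{v}_{\rm ref}=\mathbf{V}_{\rm ref}\mathbf{V}_{\rm ref}^{\sf H}$. A subset $\mathcal{N}_U\subseteq\mathcal{N}^+$ of $U=|\mathcal{N}_U|$ buses has renewable generation; $\mathbf{u}\in\mathbb{R}^{3U}$ has entries $u_j^\phi$, $j\in\mathcal{N}_U$, and $u_j^\phi:=0$ for $j\notin\mathcal{N}_U$. Matrices that are $\succeq0$ are Hermitian positive semidefinite. SDP PE$(\mathbf{u})$ with weight $\beta>0$: minimize $\beta\sum_{k=1}^6\sum_{j\in\mathcal{N}^+,\phi}z_{kj}^\phi+\mathrm{tr}(\mathbf{C}\mathbf{W})$ over Hermitian $\mathbf{W}\succeq0$ of size $3(N+1)$ and $z_{kj}^\phi\ge0$ subject to, for all $j\in\mathcal{N}^+$ and $\phi$: $\mathrm{tr}(\bm{\mathcal{P}}_j^\phi\mathbf{W})-u_j^\phi-\overline{p}_j^\phi\le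 z_{1j}^\phi$; $-\mathrm{tr}(\bm{\mathcal{P}}_j^\phi\mathbf{W})+u_j^\phi+\underline{p}_j^\phi\le z_{2j}^\phi$; $\mathrm{tr}(\bm{\mathcal{Q}}_j^\phi\mathbf{W})-\overline{q}_j^\phi\le z_{3j}^\phi$; $-\mathrm{tr}(\bm{\mathcal{Q}}_j^\phi\mathbf{W})+\underline{q}_j^\phi\le z_{4j}^\phi$; $\mathrm{tr}(\mathbf{E}_j^\phi\mathbf{W})-\overline{v}_j^\phi\le z_{5j}^\phi$; $-\mathrm{tr}(\mathbf{E}_j^\phi\mathbf{W})+\underline{v}_j^\phi\le z_{6j}^\phi$; and $[\mathbf{W}]_{00}=\bm{v}_{\rm ref}$. *)

theory Defs
  imports
    "Jordan_Normal_Form.Schur_Decomposition"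
    "Jordan_Normal_Form.DL_Rank"
begin

text \<open>
  Buses are the numbers \<open>0..N\<close>, with slack bus \<open>0\<close>. Since vectors and matrices are indexed from
  \<open>0\<close>, the three phases are \<open>\<phi> < 3\<close>, and phase \<open>\<phi>\<close> of bus \<open>j\<close> has index \<open>3 * j + \<phi>\<close>.
\<close>

section \<open>Matrices\<close>

definition tr :: "complex mat \<Rightarrow> complex" where
  "tr A = (\<Sum>i<dim_row A. A $$ (i, i))"

text \<open>\<open>outer x w\<close> is the matrix \<open>x w\<^sup>H\<close>.\<close>

definition outer :: "complex vec \<Rightarrow> complex vec \<Rightarrow> complex mat" where
  "outer x w = mat (dim_vec x) (dim_vec w) (\<lambda>(r, c). x $ r * cnj (w $ c))"

text \<open>The inner product \<open>(A *\<^sub>v x) \<bullet>c x\<close> is \<open>x\<^sup>H A x\<close>, which is real for Hermitian \<open>A\<close>.\<close>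

definition hermitian_psd :: "nat \<Rightarrow> complex mat \<Rightarrow> bool" where
  "hermitian_psd n A \<longleftrightarrow>
     A \<in> carrier_mat n n \<and> mat_adjoint A = A \<and>
     (\<forall>x \<in> carrier_vec n. 0 \<le> Re ((A *\<^sub>v x) \<bullet>c x))"

definition strictly_diag_dominant :: "real mat \<Rightarrow> bool" where
  "strictly_diag_dominant A \<longleftrightarrow>
     (\<forall>r < dim_row A. (\<Sum>c \<in> {..<dim_col A} - {r}. \<bar>A $$ (r, c)\<bar>) < \<bar>A $$ (r, r)\<bar>)"

definition block :: "complex mat \<Rightarrow> nat \<Rightarrow> nat \<Rightarrow> complex mat" where
  "block X j k = mat 3 3 (\<lambda>(a, b). X $$ (3 * j + a, 3 * k + b))"

section \<open>Network\<close>

text \<open>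
  An undirected simple graph is a symmetric irreflexive relation \<open>E\<close>, so each line occurs in both
  orientations. The predicate \<open>tree\<close> of the entry Graph\_Theory is not suitable, as it excludes
  only directed cycles.
\<close>

definition simple_graph :: "nat \<Rightarrow> (nat \<times> nat) set \<Rightarrow> bool" where
  "simple_graph N E \<longleftrightarrow> E \<subseteq> {0..N} \<times> {0..N} \<and> sym E \<and> irrefl E"

definition is_cycle :: "(nat \<times> nat) set \<Rightarrow> nat list \<Rightarrow> bool" where
  "is_cycle E vs \<longleftrightarrow>
     3 \<le> length vs \<and> distinct vs \<and>
     (\<forall>i. Suc i < length vs \<longrightarrow> (vs ! i, vs ! Suc i) \<in> E) \<and> (last vs, hd vs) \<in> E"

definition tree_graph :: "nat \<Rightarrow> (nat \<times> nat) set \<Rightarrow> bool" where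
  "tree_graph N E \<longleftrightarrow>
     simple_graph N E \<and> (\<forall>j \<in> {0..N}. \<forall>k \<in> {0..N}. (j, k) \<in> E\<^sup>*) \<and> (\<nexists>vs. is_cycle E vs)"

definition line_admittances :: "(nat \<times> nat) set \<Rightarrow> (nat \<Rightarrow> nat \<Rightarrow> complex mat) \<Rightarrow> bool" where
  "line_admittances E y \<longleftrightarrow> (\<forall>(j, k) \<in> E. y j k \<in> carrier_mat 3 3 \<and> y j k = y k j)"

definition admittance_block ::
  "(nat \<times> nat) set \<Rightarrow> (nat \<Rightarrow> nat \<Rightarrow> complex mat) \<Rightarrow> nat \<Rightarrow> nat \<Rightarrow> complex mat" where
  "admittance_block E y j k =
     (if j = k then mat 3 3 (\<lambda>(a, b). \<Sum>l | (j, l) \<in> E. y j l $$ (a, b))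
      else if (j, k) \<in> E then - y j k
      else 0\<^sub>m 3 3)"

definition Ymat ::
  "nat \<Rightarrow> (nat \<times> nat) set \<Rightarrow> (nat \<Rightarrow> nat \<Rightarrow> complex mat) \<Rightarrow> complex mat" where
  "Ymat N E y = mat (3 * (N + 1)) (3 * (N + 1))
     (\<lambda>(r, c). admittance_block E y (r div 3) (c div 3) $$ (r mod 3, c mod 3))"

definition Emat :: "nat \<Rightarrow> nat \<Rightarrow> nat \<Rightarrow> complex mat" where
  "Emat N j \<phi> =
     outer (unit_vec (3 * (N + 1)) (3 * j + \<phi>)) (unit_vec (3 * (N + 1)) (3 * j + \<phi>))"

definition Ymat_at ::
  "nat \<Rightarrow> (nat \<times> nat) set \<Rightarrow> (nat \<Rightarrow> nat \<Rightarrow> complex mat) \<Rightarrow> nat \<Rightarrow> nat \<Rightarrow> complex mat" where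
  "Ymat_at N E y j \<phi> = Emat N j \<phi> * Ymat N E y"

definition Pmat ::
  "nat \<Rightarrow> (nat \<times> nat) set \<Rightarrow> (nat \<Rightarrow> nat \<Rightarrow> complex mat) \<Rightarrow> nat \<Rightarrow> nat \<Rightarrow> complex mat" where
  "Pmat N E y j \<phi> =
     (1 / 2) \<cdot>\<^sub>m (mat_adjoint (Ymat_at N E y j \<phi>) + Ymat_at N E y j \<phi>)"

definition Qmat ::
  "nat \<Rightarrow> (nat \<times> nat) set \<Rightarrow> (nat \<Rightarrow> nat \<Rightarrow> complex mat) \<Rightarrow> nat \<Rightarrow> nat \<Rightarrow> complex mat" where
  "Qmat N E y j \<phi> =
     (1 / (2 * \<i>)) \<cdot>\<^sub>m (mat_adjoint (Ymat_at N E y j \<phi>) - Ymat_at N E y j \<phi>)"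

definition Cmat ::
  "nat \<Rightarrow> (nat \<times> nat) set \<Rightarrow> (nat \<Rightarrow> nat \<Rightarrow> complex mat) \<Rightarrow> complex mat" where
  "Cmat N E y = (1 / 2) \<cdot>\<^sub>m (Ymat N E y + mat_adjoint (Ymat N E y))"

section \<open>The penalized semidefinite program\<close>

record limits =
  p_min :: "nat \<Rightarrow> nat \<Rightarrow> real"
  p_max :: "nat \<Rightarrow> nat \<Rightarrow> real"
  q_min :: "nat \<Rightarrow> nat \<Rightarrow> real"
  q_max :: "nat \<Rightarrow> nat \<Rightarrow> real"
  V_min :: "nat \<Rightarrow> nat \<Rightarrow> real"
  V_max :: "nat \<Rightarrow> nat \<Rightarrow> real"

definition valid_limits :: "nat \<Rightarrow> limits \<Rightarrow> bool" where
  "valid_limits N L \<longleftrightarrow>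
     (\<forall>j \<in> {1..N}. \<forall>\<phi> < 3.
        p_min L j \<phi> \<le> p_max L j \<phi> \<and>
        q_min L j \<phi> \<le> q_max L j \<phi> \<and>
        0 \<le> V_min L j \<phi> \<and> V_min L j \<phi> \<le> V_max L j \<phi>)"

text \<open>
  A vector \<open>u\<close> in dimension \<open>3 * card NU\<close>, indexed by the buses of \<open>NU\<close> and the phases, is a
  function of bus and phase of which only the values on \<open>NU\<close> are used.
\<close>

definition renewable :: "nat set \<Rightarrow> (nat \<Rightarrow> nat \<Rightarrow> real) \<Rightarrow> nat \<Rightarrow> nat \<Rightarrow> real" where
  "renewable NU u j \<phi> = (if j \<in> NU then u j \<phi> else 0)"

text \<open>
  The slack variables are written \<open>z k j \<phi>\<close> with \<open>k\<close> from \<open>1\<close> to \<open>6\<close>. The matrices in the traces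
  below are Hermitian, so these traces are real and \<open>Re\<close> only changes the type.
\<close>

definition PE_feasible ::
  "nat \<Rightarrow> (nat \<times> nat) set \<Rightarrow> (nat \<Rightarrow> nat \<Rightarrow> complex mat) \<Rightarrow> limits \<Rightarrow> complex vec \<Rightarrow> nat set \<Rightarrow>
   (nat \<Rightarrow> nat \<Rightarrow> real) \<Rightarrow> complex mat \<Rightarrow> (nat \<Rightarrow> nat \<Rightarrow> nat \<Rightarrow> real) \<Rightarrow> bool" where
  "PE_feasible N E y L Vref NU u W z \<longleftrightarrow>
     hermitian_psd (3 * (N + 1)) W \<and>
     (\<forall>k \<in> {1..6}. \<forall>j \<in> {1..N}. \<forall>\<phi> < 3. 0 \<le> z k j \<phi>) \<and>
     (\<forall>j \<in> {1..N}. \<forall>\<phi> < 3.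
        Re (tr (Pmat N E y j \<phi> * W)) - renewable NU u j \<phi> - p_max L j \<phi> \<le> z 1 j \<phi> \<and>
        - Re (tr (Pmat N E y j \<phi> * W)) + renewable NU u j \<phi> + p_min L j \<phi> \<le> z 2 j \<phi> \<and>
        Re (tr (Qmat N E y j \<phi> * W)) - q_max L j \<phi> \<le> z 3 j \<phi> \<and>
        - Re (tr (Qmat N E y j \<phi> * W)) + q_min L j \<phi> \<le> z 4 j \<phi> \<and>
        Re (tr (Emat N j \<phi> * W)) - (V_max L j \<phi>)\<^sup>2 \<le> z 5 j \<phi> \<and>
        - Re (tr (Emat N j \<phi> * W)) + (V_min L j \<phi>)\<^sup>2 \<le> z 6 j \<phi>) \<and>
     block W 0 0 = outer Vref Vref"

definition PE_objective ::
  "nat \<Rightarrow> (nat \<times> nat) set \<Rightarrow> (nat \<Rightarrow> nat \<Rightarrow> complex mat) \<Rightarrow> real \<Rightarrow>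
   complex mat \<Rightarrow> (nat \<Rightarrow> nat \<Rightarrow> nat \<Rightarrow> real) \<Rightarrow> real" where
  "PE_objective N E y \<beta> W z =
     \<beta> * (\<Sum>k = 1..6. \<Sum>j = 1..N. \<Sum>\<phi><3. z k j \<phi>) + Re (tr (Cmat N E y * W))"

definition PE_optimal ::
  "nat \<Rightarrow> (nat \<times> nat) set \<Rightarrow> (nat \<Rightarrow> nat \<Rightarrow> complex mat) \<Rightarrow> limits \<Rightarrow> complex vec \<Rightarrow> nat set \<Rightarrow>
   real \<Rightarrow> (nat \<Rightarrow> nat \<Rightarrow> real) \<Rightarrow> complex mat \<Rightarrow> (nat \<Rightarrow> nat \<Rightarrow> nat \<Rightarrow> real) \<Rightarrow> bool" where
  "PE_optimal N E y L Vref NU \<beta> u W z \<longleftrightarrow>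
     PE_feasible N E y L Vref NU u W z \<and>
     (\<forall>W' z'. PE_feasible N E y L Vref NU u W' z' \<longrightarrow>
        PE_objective N E y \<beta> W z \<le> PE_objective N E y \<beta> W' z')"

end

theory Submission
  imports Defs
begin

text \<open>
  Feasible points are perturbed by rank-one matrices \<open>x x\<^sup>H\<close> whose \<open>x\<close> vanishes at the slack bus. Such
  a perturbation keeps the slack block, moves each constraint by at most a constant times
  \<open>\<parallel>x\<parallel>\<^sup>2\<close>, so the penalty grows by \<open>O(\<beta> \<parallel>x\<parallel>\<^sup>2)\<close>, and changes the loss by the loss form
  \<open>x\<^sup>H C x\<close>, which is half the sum over the oriented lines of the conductance forms of the
  voltage drops.

  If some conductance matrix has a negative diagonal entry, the loss form is negative at an indicator
  of one side of the cut that the line defines in the tree; adding \<open>x x\<^sup>H\<close> shows that for small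
  \<open>\<beta>\<close> there is no optimal solution. Otherwise diagonal dominance makes all conductance matrices
  positive definite, and by connectedness the loss form is at least \<open>c \<parallel>x\<parallel>\<^sup>2\<close> off the slack bus.
  If \<open>W\<close> differs from the rank-one matrix that its slack columns determine, then some
  \<open>x x\<^sup>H\<close> with \<open>x \<noteq> 0\<close> can be subtracted from it, which lowers the objective for small
  \<open>\<beta>\<close>.
\<close>

section \<open>Sesquilinear forms and positive semidefinite matrices\<close>

text \<open>The value g^H A f. Plain functions replace vectors here, so linear combinations and
  indicators need no carrier conditions.\<close>

definition sform :: "nat \<Rightarrow> complex mat \<Rightarrow> (nat \<Rightarrow> complex) \<Rightarrow> (nat \<Rightarrow> complex) \<Rightarrow> complex" where
  "sform n A f g = (\<Sum>i<n. \<Sum>j<n. A $$ (i, j) * f j * cnj (g i))"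

lemma sform_cong:
  assumes "\<And>i. i < n \<Longrightarrow> f i = f' i" and "\<And>i. i < n \<Longrightarrow> g i = g' i"
  shows "sform n A f g = sform n A f' g'"
  using assms by (simp add: sform_def)

lemma sform_add_left: "sform n A (\<lambda>i. f i + c * g i) h = sform n A f h + c * sform n A g h"
  by (simp add: sform_def algebra_simps sum.distrib sum_distrib_left)

lemma sform_add_right: "sform n A h (\<lambda>i. f i + c * g i) = sform n A h f + cnj c * sform n A h g"
  by (simp add: sform_def algebra_simps sum.distrib sum_distrib_left)

lemma sform_add:
  assumes "A \<in> carrier_mat n n" and "B \<in> carrier_mat n n"
  shows "sform n (A + B) f g = sform n A f g + sform n B f g"
  using assms by (simp add: sform_def algebra_simps sum.distrib)

lemma sform_diff:
  assumes "A \<in> carrier_mat n n" and "B \<in> carrier_mat n n"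
  shows "sform n (A - B) f g = sform n A f g - sform n B f g"
  using assms by (simp add: sform_def algebra_simps sum_subtractf)

section \<open>Rank-one matrices and traces\<close>

lemma dim_outer [simp]: "dim_row (outer x w) = dim_vec x" "dim_col (outer x w) = dim_vec w"
  by (simp_all add: outer_def)

lemma outer_carrier [simp]:
  "x \<in> carrier_vec n \<Longrightarrow> w \<in> carrier_vec m \<Longrightarrow> outer x w \<in> carrier_mat n m"
  by (simp add: outer_def)

lemma outer_index [simp]:
  "i < dim_vec x \<Longrightarrow> j < dim_vec w \<Longrightarrow> outer x w $$ (i, j) = x $ i * cnj (w $ j)"
  by (simp add: outer_def)

lemma sform_outer:
  assumes "x \<in> carrier_vec n"
  shows "sform n (outer x x) f g = (\<Sum>i<n. cnj (x $ i) * f i) * cnj (\<Sum>i<n. cnj (x $ i) * g i)"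
proof -
  have "sform n (outer x x) f g = (\<Sum>i<n. \<Sum>j<n. (x $ i * cnj (g i)) * (cnj (x $ j) * f j))"
    unfolding sform_def using assms by (intro sum.cong refl) (auto simp: mult_ac)
  also have "\<dots> = (\<Sum>i<n. x $ i * cnj (g i)) * (\<Sum>j<n. cnj (x $ j) * f j)"
    by (simp add: sum_product)
  finally show ?thesis by (simp add: mult.commute)
qed

lemma cscalar_mult_mat_vec:
  assumes "A \<in> carrier_mat n n" and "x \<in> carrier_vec n" and "w \<in> carrier_vec n"
  shows "(A *\<^sub>v x) \<bullet>c w = sform n A (\<lambda>i. x $ i) (\<lambda>i. w $ i)"
  using assms by (auto simp: sform_def scalar_prod_def lessThan_atLeast0 sum_distrib_right intro!: sum.cong)

lemma tr_mult_outer: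
  assumes "A \<in> carrier_mat n n" and "x \<in> carrier_vec n"
  shows "tr (A * outer x x) = sform n A (\<lambda>i. x $ i) (\<lambda>i. x $ i)"
  using assms
  by (auto simp: tr_def sform_def scalar_prod_def lessThan_atLeast0 mult.assoc intro!: sum.cong)

lemma tr_mult_add:
  assumes "A \<in> carrier_mat n n" and "B \<in> carrier_mat n n" and "C \<in> carrier_mat n n"
  shows "tr (A * (B + C)) = tr (A * B) + tr (A * C)"
  using assms by (simp add: mult_add_distrib_mat[of A n n] tr_def sum.distrib)

lemma tr_mult_diff:
  assumes "A \<in> carrier_mat n n" and "B \<in> carrier_mat n n" and "C \<in> carrier_mat n n"
  shows "tr (A * (B - C)) = tr (A * B) - tr (A * C)"
  using assms by (simp add: mult_minus_distrib_mat[of A n n] tr_def sum_subtractf)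

section \<open>Hermitian and positive semidefinite matrices\<close>

lemma mat_adjoint_carrier:
  "A \<in> carrier_mat n m \<Longrightarrow> mat_adjoint A \<in> carrier_mat m n"
  by (auto simp: mat_adjoint_def)

lemma mat_adjoint_index:
  assumes "A \<in> carrier_mat n n" and "i < n" and "j < n"
  shows "mat_adjoint A $$ (i, j) = cnj (A $$ (j, i))"
  using assms by (simp add: mat_adjoint_def mat_of_rows_index)

lemma mat_adjoint_eq_iff:
  assumes "A \<in> carrier_mat n n"
  shows "mat_adjoint A = A \<longleftrightarrow> (\<forall>i<n. \<forall>j<n. cnj (A $$ (i, j)) = A $$ (j, i))"
  using assms mat_adjoint_index[OF assms] mat_adjoint_carrier[OF assms]
  by (metis carrier_matD complex_cnj_cnj eq_matI)

text \<open>The entrywise description used from here on. A function f enters the form only through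
  its values below n, so it may be exchanged for \<open>vec n f\<close>.\<close>

lemma hermitian_psd_iff:
  "hermitian_psd n A \<longleftrightarrow> A \<in> carrier_mat n n \<and>
     (\<forall>i<n. \<forall>j<n. cnj (A $$ (i, j)) = A $$ (j, i)) \<and> (\<forall>f. 0 \<le> Re (sform n A f f))"
proof -
  have "(\<forall>x \<in> carrier_vec n. 0 \<le> Re ((A *\<^sub>v x) \<bullet>c x)) \<longleftrightarrow> (\<forall>f. 0 \<le> Re (sform n A f f))"
    if A: "A \<in> carrier_mat n n"
  proof (intro iffI allI ballI)
    fix f assume *: "\<forall>x \<in> carrier_vec n. 0 \<le> Re ((A *\<^sub>v x) \<bullet>c x)"
    have "sform n A f f = (A *\<^sub>v vec n f) \<bullet>c vec n f"
      using A by (simp add: cscalar_mult_mat_vec cong: sform_cong)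
    then show "0 \<le> Re (sform n A f f)" using * by auto
  next
    fix x :: "complex vec" assume "\<forall>f. 0 \<le> Re (sform n A f f)" and "x \<in> carrier_vec n"
    then show "0 \<le> Re ((A *\<^sub>v x) \<bullet>c x)" using cscalar_mult_mat_vec[OF A] by simp
  qed
  then show ?thesis unfolding hermitian_psd_def using mat_adjoint_eq_iff by blast
qed

lemma hermitian_psd_add:
  assumes "hermitian_psd n A" and "hermitian_psd n B"
  shows "hermitian_psd n (A + B)"
proof -
  have "A \<in> carrier_mat n n" "B \<in> carrier_mat n n"
    using assms by (auto simp: hermitian_psd_iff)
  then show ?thesis using assms unfolding hermitian_psd_iff by (auto simp: sform_add)
qed

lemma hermitian_psd_outer:
  assumes "x \<in> carrier_vec n"
  shows "hermitian_psd n (outer x x)"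
proof -
  \<comment> \<open>The form of x x^H at f is the squared modulus of x^H f.\<close>
  have "0 \<le> Re (sform n (outer x x) f f)" for f
    using assms unfolding sform_outer[OF assms] complex_mult_cnj by (simp del: of_real_power)
  then show ?thesis using assms by (auto simp: hermitian_psd_iff)
qed

lemma sform_adjoint:
  assumes "A \<in> carrier_mat n n"
  shows "sform n (mat_adjoint A) f g = cnj (sform n A g f)"
  unfolding sform_def cnj_sum
  by (subst sum.swap) (auto intro!: sum.cong simp: mat_adjoint_index[OF assms])

lemma sform_hermitian:
  assumes "A \<in> carrier_mat n n" and "\<forall>i<n. \<forall>j<n. cnj (A $$ (i, j)) = A $$ (j, i)"
  shows "cnj (sform n A f g) = sform n A g f"
  using sform_adjoint[OF assms(1)] mat_adjoint_eq_iff[OF assms(1)] assms(2) by metis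

text \<open>With w = A v, the form at w + t v is affine in the real number t, because the quadratic
  term is zero. It is nonnegative for every t, so its slope, twice the squared norm of A v, must
  vanish.\<close>

lemma hermitian_psd_kernel:
  assumes psd: "hermitian_psd n A" and zero: "Re (sform n A v v) = 0" and i: "i < n"
  shows "(\<Sum>k<n. A $$ (i, k) * v k) = 0"
proof -
  define w where "w i = (\<Sum>k<n. A $$ (i, k) * v k)" for i
  define s where "s = (\<Sum>i<n. (cmod (w i))\<^sup>2)"
  have A: "A \<in> carrier_mat n n"
    and herm: "\<forall>i<n. \<forall>j<n. cnj (A $$ (i, j)) = A $$ (j, i)"
    and pos: "\<And>f. 0 \<le> Re (sform n A f f)"
    using psd by (auto simp: hermitian_psd_iff)
  have vw: "sform n A v w = of_real s"
  proof -
    have "sform n A v w = (\<Sum>i<n. w i * cnj (w i))"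
      by (simp add: sform_def w_def sum_distrib_right)
    then show ?thesis by (simp add: s_def flip: complex_norm_square)
  qed
  then have wv: "sform n A w v = of_real s"
    using sform_hermitian[OF A herm, of v w] by simp
  have "0 \<le> Re (sform n A w w) + 2 * t * s" for t :: real
  proof -
    have "sform n A (\<lambda>i. w i + of_real t * v i) (\<lambda>i. w i + of_real t * v i)
       = sform n A w w + of_real (2 * t * s) + of_real (t\<^sup>2) * sform n A v v"
      unfolding sform_add_left unfolding sform_add_right vw wv
      by (simp add: algebra_simps power2_eq_square)
    then have "0 \<le> Re (sform n A w w + of_real (2 * t * s) + of_real (t\<^sup>2) * sform n A v v)"
      using pos by metis
    then show ?thesis using zero by simp
  qed
  note nonneg = this
  have "s = 0"
  proof (rule ccontr)
    assume "s \<noteq> 0"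
    \<comment> \<open>The argument is chosen so that the affine function takes the value -1.\<close>
    then have "2 * (- (Re (sform n A w w) + 1) / (2 * s)) * s = - (Re (sform n A w w) + 1)"
      by simp
    then show False using nonneg[of "- (Re (sform n A w w) + 1) / (2 * s)"] by linarith
  qed
  then have "w i = 0"
    unfolding s_def using i by (subst (asm) sum_nonneg_eq_0_iff) auto
  then show ?thesis by (simp add: w_def)
qed

text \<open>
  The Schur complement along \<open>v\<close>: since \<open>x\<close> is \<open>A v\<close> normalised, the value of the form of
  \<open>A - x x\<^sup>H\<close> at \<open>f\<close> is that of \<open>A\<close> at the component of \<open>f\<close> that is \<open>A\<close>-orthogonal to \<open>v\<close>.
\<close>

lemma hermitian_psd_deflate:
  assumes psd: "hermitian_psd n A" and b: "b = Re (sform n A v v)" "0 < b"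
    and x: "x = vec n (\<lambda>i. (\<Sum>k<n. A $$ (i, k) * v k) / of_real (sqrt b))"
  shows "hermitian_psd n (A - outer x x)"
proof -
  have A: "A \<in> carrier_mat n n"
    and herm: "\<forall>i<n. \<forall>j<n. cnj (A $$ (i, j)) = A $$ (j, i)"
    and pos: "\<And>f. 0 \<le> Re (sform n A f f)"
    using psd by (auto simp: hermitian_psd_iff)
  have xc: "x \<in> carrier_vec n" by (simp add: x)
  have vv: "sform n A v v = of_real b"
    using sform_hermitian[OF A herm, of v v] b by (auto simp: complex_eq_iff)
  have "0 \<le> Re (sform n (A - outer x x) f f)" for f
  proof -
    define c where "c = sform n A f v"
    have vf: "sform n A v f = cnj c"
      using sform_hermitian[OF A herm, of f v] by (simp add: c_def)
    have "(\<Sum>i<n. cnj (x $ i) * f i) = cnj (sform n A v f) / of_real (sqrt b)"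
      by (simp add: x sform_def sum_divide_distrib sum_distrib_right)
    then have "(\<Sum>i<n. cnj (x $ i) * f i) = c / of_real (sqrt b)"
      by (simp add: vf)
    then have "sform n (outer x x) f f = c * cnj c / (of_real (sqrt b) * of_real (sqrt b))"
      using xc by (simp add: sform_outer)
    also have "\<dots> = c * cnj c / of_real b"
      using b by (simp flip: of_real_mult)
    finally have o: "sform n (outer x x) f f = c * cnj c / of_real b" .
    have "sform n A (\<lambda>i. f i + (- c / of_real b) * v i) (\<lambda>i. f i + (- c / of_real b) * v i)
       = sform n A f f - c * cnj c / of_real b"
      unfolding sform_add_left unfolding sform_add_right vv vf c_def[symmetric]
      using b by (simp add: field_simps)
    also have "\<dots> = sform n (A - outer x x) f f"
      using A xc by (simp add: sform_diff o)
    finally show ?thesis using pos by metis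
  qed
  moreover have "cnj ((A - outer x x) $$ (i, j)) = (A - outer x x) $$ (j, i)" if "i < n" "j < n" for i j
    using that A xc herm[rule_format, OF that] by simp
  ultimately show ?thesis
    using A minus_carrier_mat[OF outer_carrier[OF xc xc], of A] unfolding hermitian_psd_iff by blast
qed

lemma sform_indicator:
  assumes "i < n" and "j < n"
  shows "sform n A (\<lambda>k. of_bool (k = j)) (\<lambda>k. of_bool (k = i)) = A $$ (i, j)"
proof -
  have "sform n A (\<lambda>k. of_bool (k = j)) (\<lambda>k. of_bool (k = i))
     = (\<Sum>r<n. if r = i then \<Sum>k<n. if k = j then A $$ (r, k) else 0 else 0)"
    unfolding sform_def by (intro sum.cong refl) auto
  then show ?thesis using assms by simp
qed

text \<open>A zero diagonal entry makes the indicator of j a null vector of the form, so column j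
  vanishes by \<open>hermitian_psd_kernel\<close>, and row j by symmetry.\<close>

lemma hermitian_psd_diag_zero:
  assumes "hermitian_psd n A" and "i < n" "j < n" and "Re (A $$ (j, j)) = 0"
  shows "A $$ (i, j) = 0" and "A $$ (j, i) = 0"
proof -
  have "(\<Sum>k<n. A $$ (i, k) * of_bool (k = j)) = 0"
    using assms by (intro hermitian_psd_kernel) (auto simp: sform_indicator)
  also have "(\<Sum>k<n. A $$ (i, k) * of_bool (k = j)) = (\<Sum>k<n. if k = j then A $$ (i, k) else 0)"
    by (intro sum.cong) auto
  finally show "A $$ (i, j) = 0" using assms by simp
  then show "A $$ (j, i) = 0"
    using assms unfolding hermitian_psd_iff by (metis complex_cnj_zero)
qed

section \<open>Bound on a form and rank of an outer product\<close>

definition sqnorm :: "nat \<Rightarrow> (nat \<Rightarrow> complex) \<Rightarrow> real" where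
  "sqnorm n f = (\<Sum>i<n. (cmod (f i))\<^sup>2)"

text \<open>A crude bound from the inequality of arithmetic and geometric means, applied to each
  pair of entries of f. What matters is that the constant depends on A alone.\<close>

lemma sform_bound:
  "cmod (sform n A f f) \<le> (\<Sum>i<n. \<Sum>j<n. cmod (A $$ (i, j))) * sqnorm n f"
proof -
  have "cmod (sform n A f f) \<le> (\<Sum>i<n. \<Sum>j<n. cmod (A $$ (i, j) * f j * cnj (f i)))"
    unfolding sform_def by (rule order_trans[OF norm_sum sum_mono]) (rule norm_sum)
  also have "\<dots> \<le> (\<Sum>i<n. \<Sum>j<n. cmod (A $$ (i, j)) * sqnorm n f)"
  proof (intro sum_mono)
    fix i j assume ij: "i \<in> {..<n}" "j \<in> {..<n}"
    have s: "(cmod (f k))\<^sup>2 \<le> sqnorm n f" if "k < n" for k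
      unfolding sqnorm_def using that by (intro member_le_sum) auto
    have "2 * (cmod (f j) * cmod (f i)) \<le> (cmod (f j))\<^sup>2 + (cmod (f i))\<^sup>2"
      using sum_squares_bound[of "cmod (f j)" "cmod (f i)"] by simp
    also have "\<dots> \<le> 2 * sqnorm n f" using s[of i] s[of j] ij by simp
    finally show "cmod (A $$ (i, j) * f j * cnj (f i)) \<le> cmod (A $$ (i, j)) * sqnorm n f"
      by (simp add: norm_mult mult.assoc mult_left_mono)
  qed
  also have "\<dots> = (\<Sum>i<n. \<Sum>j<n. cmod (A $$ (i, j))) * sqnorm n f"
    by (simp add: sum_distrib_right)
  finally show ?thesis .
qed

text \<open>All columns are multiples of V, which bounds the rank by 1; the column at an index where
  V is nonzero is itself nonzero, which gives the reverse bound.\<close>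

lemma rank_outer:
  assumes V: "V \<in> carrier_vec n" and nz: "V \<noteq> 0\<^sub>v n"
  shows "vec_space.rank n (outer V V) = 1"
proof -
  interpret vec_space "TYPE(complex)" n .
  have c: "outer V V \<in> carrier_mat n n" using V by simp
  have "rank (outer V V) \<le> 1"
    using V by (intro rank_le_1_product_entries[OF c, where f = "\<lambda>r. V $ r" and g = "\<lambda>c. cnj (V $ c)"]) auto
  moreover obtain i where i: "i < n" "V $ i \<noteq> 0"
    using V nz by (metis carrier_vecD eq_vecI index_zero_vec)
  have "1 \<le> rank (outer V V)"
  proof -
    define w where "w = col (outer V V) i"
    have w: "w \<in> carrier_vec n" "w \<noteq> 0\<^sub>v n"
      using i V by (auto simp: w_def vec_eq_iff)
    have "lin_indpt {w}"
    proof (rule finite_lin_indpt2)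
      fix a assume "lincomb a {w} = 0\<^sub>v n"
      then have "a w \<cdot>\<^sub>v w = 0\<^sub>v n"
        using w by (simp add: lincomb_def module_vec_simps finsum_vec)
      then show "\<forall>v\<in>{w}. a v = 0"
        using w by (auto simp: vec_eq_iff class_ring_simps)
    qed (use w in auto)
    moreover have "{w} \<subseteq> set (cols (outer V V))"
      using i V c by (auto simp: w_def cols_def)
    ultimately show ?thesis using rank_ge_card_indpt[OF c, of "{w}"] by simp
  qed
  ultimately show ?thesis by simp
qed

section \<open>The loss form of the network\<close>

lemma sum_buses: "(\<Sum>i<3 * m. f i) = (\<Sum>j<m. \<Sum>a<3. f (3 * j + a))" for f :: "nat \<Rightarrow> 'a::comm_monoid_add"
proof (induction m)
  case (Suc m)
  have "(\<Sum>i<3 * Suc m. f i) = (\<Sum>i<3 * m. f i) + (\<Sum>a<3. f (3 * m + a))"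
    by (simp add: eval_nat_numeral add.assoc)
  then show ?case using Suc by simp
qed simp

lemma Ymat_carrier: "Ymat N E y \<in> carrier_mat (3 * (N + 1)) (3 * (N + 1))"
  by (simp add: Ymat_def)

lemma Ymat_index:
  assumes "j < N + 1" "k < N + 1" "a < 3" "b < 3"
  shows "Ymat N E y $$ (3 * j + a, 3 * k + b) = admittance_block E y j k $$ (a, b)"
proof -
  have "3 * j + a < 3 * (N + 1)" "3 * k + b < 3 * (N + 1)" using assms by auto
  then show ?thesis using assms by (simp add: Ymat_def)
qed

definition edge_form :: "complex mat \<Rightarrow> (nat \<Rightarrow> complex) \<Rightarrow> complex" where
  "edge_form Z d = (\<Sum>a<3. \<Sum>b<3. Z $$ (a, b) * d b * cnj (d a))"

definition voltage_drop :: "(nat \<Rightarrow> complex) \<Rightarrow> nat \<Rightarrow> nat \<Rightarrow> nat \<Rightarrow> complex" where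
  "voltage_drop x j k a = x (3 * j + a) - x (3 * k + a)"

lemma simple_graph_finite:
  assumes "simple_graph N E"
  shows "finite E"
  using assms unfolding simple_graph_def by (meson finite_SigmaI finite_atLeastAtMost finite_subset)

lemma sum_swap_edges:
  assumes "sym E"
  shows "(\<Sum>(j, k)\<in>E. f j k) = (\<Sum>(j, k)\<in>E. f k j)"
  by (rule sum.reindex_bij_witness[where i = prod.swap and j = prod.swap])
    (use assms in \<open>auto dest: symD\<close>)

text \<open>The diagonal block is the sum of the incident line admittances, so the injected current
  depends on voltage drops only.\<close>

lemma Ymat_row:
  assumes g: "simple_graph N E" and y: "line_admittances E y" and ja: "j < N + 1" "a < 3" "b < 3"
  shows "(\<Sum>k<N+1. admittance_block E y j k $$ (a, b) * x (3 * k + b))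
       = (\<Sum>k | (j, k) \<in> E. y j k $$ (a, b) * voltage_drop x j k b)"
proof -
  let ?S = "\<Sum>l | (j, l) \<in> E. y j l $$ (a, b)"
  have sub: "{k. (j, k) \<in> E} \<subseteq> {..<N+1}" and irr: "(j, j) \<notin> E"
    using g by (auto simp: simple_graph_def irrefl_def)
  have "(\<Sum>k<N+1. admittance_block E y j k $$ (a, b) * x (3 * k + b))
     = (\<Sum>k<N+1. (if k = j then ?S * x (3 * j + b) else 0)
          - (if k \<in> {k. (j, k) \<in> E} then y j k $$ (a, b) * x (3 * k + b) else 0))"
  proof (intro sum.cong refl)
    fix k
    have "y j k \<in> carrier_mat 3 3" if "(j, k) \<in> E"
      using that y by (auto simp: line_admittances_def)
    then show "admittance_block E y j k $$ (a, b) * x (3 * k + b)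
       = (if k = j then ?S * x (3 * j + b) else 0)
          - (if k \<in> {k. (j, k) \<in> E} then y j k $$ (a, b) * x (3 * k + b) else 0)"
      using irr ja by (auto simp: admittance_block_def)
  qed
  also have "\<dots> = ?S * x (3 * j + b) - (\<Sum>k \<in> {k. (j, k) \<in> E}. y j k $$ (a, b) * x (3 * k + b))"
    using ja sub by (simp only: sum_subtractf sum.delta finite_lessThan sum.inter_restrict[symmetric])
      (simp add: Int_absorb1)
  also have "\<dots> = (\<Sum>k | (j, k) \<in> E. y j k $$ (a, b) * voltage_drop x j k b)"
    by (simp add: voltage_drop_def right_diff_distrib sum_subtractf sum_distrib_right)
  finally show ?thesis .
qed

text \<open>Summing by rows pairs each drop with the voltage at the first bus of the oriented line.
  Under reversal the drop changes sign while the admittance does not, so adding the two orientations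
  turns that voltage into a second drop. This is also the origin of the factor 2.\<close>

lemma sform_Ymat:
  assumes g: "simple_graph N E" and y: "line_admittances E y"
  shows "2 * sform (3 * (N + 1)) (Ymat N E y) x x
       = (\<Sum>(j, k)\<in>E. edge_form (y j k) (voltage_drop x j k))"
proof -
  define F where "F j k = (\<Sum>a<3. \<Sum>b<3. y j k $$ (a, b) * voltage_drop x j k b * cnj (x (3 * j + a)))" for j k
  have sub: "E \<subseteq> {..<N+1} \<times> {..<N+1}" and sym: "sym E"
    using g by (auto simp: simple_graph_def)
  have fin: "finite {k. (j, k) \<in> E}" for j
    by (rule finite_subset[of _ "{..<N+1}"]) (use sub in auto)
  have "sform (3 * (N + 1)) (Ymat N E y) x x
     = (\<Sum>j<N+1. \<Sum>a<3. \<Sum>k<N+1. \<Sum>b<3.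
          admittance_block E y j k $$ (a, b) * x (3 * k + b) * cnj (x (3 * j + a)))"
    unfolding sform_def sum_buses by (intro sum.cong refl) (simp add: Ymat_index del: add_Suc_right)
  also have "\<dots> = (\<Sum>j<N+1. \<Sum>a<3. \<Sum>b<3.
      (\<Sum>k<N+1. admittance_block E y j k $$ (a, b) * x (3 * k + b)) * cnj (x (3 * j + a)))"
    unfolding sum_distrib_right by (intro sum.cong refl sum.swap)
  also have "\<dots> = (\<Sum>j<N+1. \<Sum>a<3. \<Sum>b<3.
      (\<Sum>k | (j, k) \<in> E. y j k $$ (a, b) * voltage_drop x j k b) * cnj (x (3 * j + a)))"
    by (intro sum.cong refl, subst Ymat_row[OF g y]) auto
  also have "\<dots> = (\<Sum>j<N+1. \<Sum>k | (j, k) \<in> E. F j k)"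
  proof (rule sum.cong[OF refl])
    fix j
    define f where "f a b k = y j k $$ (a, b) * voltage_drop x j k b * cnj (x (3 * j + a))" for a b k
    have "(\<Sum>a<3. \<Sum>b<3. \<Sum>k | (j, k) \<in> E. f a b k) = (\<Sum>a<3. \<Sum>k | (j, k) \<in> E. \<Sum>b<3. f a b k)"
      by (intro sum.cong refl sum.swap)
    also have "\<dots> = (\<Sum>k | (j, k) \<in> E. \<Sum>a<3. \<Sum>b<3. f a b k)"
      by (rule sum.swap)
    finally show "(\<Sum>a<3. \<Sum>b<3. (\<Sum>k | (j, k) \<in> E. y j k $$ (a, b) * voltage_drop x j k b) * cnj (x (3 * j + a)))
      = (\<Sum>k | (j, k) \<in> E. F j k)"
      unfolding sum_distrib_right F_def f_def .
  qed
  also have "\<dots> = (\<Sum>(j, k)\<in>Sigma {..<N+1} (\<lambda>j. {k. (j, k) \<in> E}). F j k)"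
    using fin by (intro sum.Sigma) auto
  also have "Sigma {..<N+1} (\<lambda>j. {k. (j, k) \<in> E}) = E"
    using sub by auto
  finally have *: "sform (3 * (N + 1)) (Ymat N E y) x x = (\<Sum>(j, k)\<in>E. F j k)" .
  have "2 * sform (3 * (N + 1)) (Ymat N E y) x x = (\<Sum>(j, k)\<in>E. F j k) + (\<Sum>(j, k)\<in>E. F k j)"
    using * sum_swap_edges[OF sym, of F] by simp
  also have "\<dots> = (\<Sum>(j, k)\<in>E. F j k + F k j)"
    by (simp add: sum.distrib case_prod_unfold)
  also have "\<dots> = (\<Sum>(j, k)\<in>E. edge_form (y j k) (voltage_drop x j k))"
  proof (intro sum.cong refl, clarify)
    fix j k assume "(j, k) \<in> E"
    then have "y k j = y j k" using y by (auto simp: line_admittances_def)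
    then show "F j k + F k j = edge_form (y j k) (voltage_drop x j k)"
      unfolding F_def edge_form_def sum.distrib[symmetric]
      by (intro sum.cong refl) (simp add: voltage_drop_def algebra_simps)
  qed
  finally show ?thesis .
qed

text \<open>\<open>Cmat\<close> is the Hermitian part of \<open>Ymat\<close>, and the form of an
  anti-Hermitian matrix is purely imaginary.\<close>

lemma Re_sform_Cmat:
  "Re (sform (3 * (N + 1)) (Cmat N E y) x x) = Re (sform (3 * (N + 1)) (Ymat N E y) x x)"
proof -
  let ?n = "3 * (N + 1)"
  note c = Ymat_carrier[of N E y] mat_adjoint_carrier[OF Ymat_carrier[of N E y]]
  have "sform ?n (Cmat N E y) x x = (1 / 2) * sform ?n (Ymat N E y + mat_adjoint (Ymat N E y)) x x"
    using c by (simp add: Cmat_def sform_def sum_distrib_left mult.assoc)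
  also have "\<dots> = (1 / 2) * (sform ?n (Ymat N E y) x x + cnj (sform ?n (Ymat N E y) x x))"
    using c by (simp only: sform_add sform_adjoint)
  finally have "Re (sform ?n (Cmat N E y) x x) = Re \<dots>"
    by (rule arg_cong)
  then show ?thesis by simp
qed

section \<open>Conductance forms and diagonal dominance\<close>

lemma Re_edge_form:
  assumes "Z \<in> carrier_mat 3 3" and sym: "Z = transpose_mat Z"
  shows "Re (edge_form Z d) = (\<Sum>a<3. \<Sum>b<3. Re (Z $$ (a, b)) * Re (d b * cnj (d a)))"
proof -
  \<comment> \<open>\<open>Im (d b * cnj (d a))\<close> is antisymmetric in a and b while the
    susceptances are symmetric, so this sum equals its own negative.\<close>
  define S where "S = (\<Sum>a<3. \<Sum>b<3. Im (Z $$ (a, b)) * Im (d b * cnj (d a)))"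
  have "S = (\<Sum>a<3. \<Sum>b<3. Im (Z $$ (b, a)) * Im (d a * cnj (d b)))"
    unfolding S_def by (rule sum.swap)
  also have "\<dots> = (\<Sum>a<3. \<Sum>b<3. - (Im (Z $$ (a, b)) * Im (d b * cnj (d a))))"
  proof (intro sum.cong refl)
    fix a b :: nat assume "a \<in> {..<3}" "b \<in> {..<3}"
    then have "Z $$ (b, a) = Z $$ (a, b)"
      using assms(1) by (subst sym) simp
    then show "Im (Z $$ (b, a)) * Im (d a * cnj (d b)) = - (Im (Z $$ (a, b)) * Im (d b * cnj (d a)))"
      by (simp add: algebra_simps)
  qed
  also have "\<dots> = - S" by (simp add: S_def sum_negf)
  finally have "S = 0" by simp
  moreover have "Re (edge_form Z d) = (\<Sum>a<3. \<Sum>b<3. Re (Z $$ (a, b)) * Re (d b * cnj (d a))) - S"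
    unfolding edge_form_def S_def Re_sum sum_subtractf[symmetric] mult.assoc
    by (intro sum.cong refl) simp
  ultimately show ?thesis by simp
qed

text \<open>The inserted 1 keeps \<open>Min\<close> defined on the empty set.\<close>

lemma finite_pos_lower_bound:
  fixes f :: "'a \<Rightarrow> real"
  assumes "finite A" and "\<And>a. a \<in> A \<Longrightarrow> 0 < f a"
  shows "\<exists>\<delta>>0. \<forall>a\<in>A. \<delta> \<le> f a"
  by (rule exI[of _ "Min (insert 1 (f ` A))"]) (use assms in auto)

text \<open>Each off-diagonal term is at least -|G a b| times the mean of |d a|^2 and |d b|^2. By
  symmetry these losses collect into row sums, leaving the dominance margin of row a as the
  coefficient of |d a|^2.\<close>

lemma diag_dominant_form_lower_bound:
  fixes G :: "nat \<Rightarrow> nat \<Rightarrow> real"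
  assumes sym: "\<And>a b. a < n \<Longrightarrow> b < n \<Longrightarrow> G a b = G b a"
    and dom: "\<And>a. a < n \<Longrightarrow> (\<Sum>b\<in>{..<n} - {a}. \<bar>G a b\<bar>) < G a a"
  shows "\<exists>\<delta>>0. \<forall>d. \<delta> * (\<Sum>a<n. (cmod (d a))\<^sup>2) \<le> (\<Sum>a<n. \<Sum>b<n. G a b * Re (d b * cnj (d a)))"
proof -
  \<comment> \<open>The signs in \<open>H\<close> let diagonal and off-diagonal terms obey one
    inequality; \<open>s a\<close> is the dominance margin of row a.\<close>
  define H where "H a b = (if a = b then - G a a else \<bar>G a b\<bar>)" for a b
  define s where "s a = - (\<Sum>b<n. H a b)" for a
  have "0 < s a" if "a < n" for a
  proof -
    have "(\<Sum>b<n. H a b) = H a a + (\<Sum>b\<in>{..<n} - {a}. H a b)"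
      using that by (simp add: sum.remove)
    also have "(\<Sum>b\<in>{..<n} - {a}. H a b) = (\<Sum>b\<in>{..<n} - {a}. \<bar>G a b\<bar>)"
      by (intro sum.cong) (auto simp: H_def)
    finally show ?thesis using dom[OF that] by (simp add: s_def H_def)
  qed
  then obtain \<delta> where \<delta>: "\<delta> > 0" "\<And>a. a < n \<Longrightarrow> \<delta> \<le> s a"
    using finite_pos_lower_bound[of "{..<n}" s] by auto
  have "\<delta> * (\<Sum>a<n. (cmod (d a))\<^sup>2) \<le> (\<Sum>a<n. \<Sum>b<n. G a b * Re (d b * cnj (d a)))" for d
  proof -
    have "(\<Sum>a<n. \<Sum>b<n. H a b * (cmod (d b))\<^sup>2) = (\<Sum>a<n. \<Sum>b<n. H b a * (cmod (d a))\<^sup>2)"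
      by (rule sum.swap)
    also have "\<dots> = (\<Sum>a<n. \<Sum>b<n. H a b * (cmod (d a))\<^sup>2)"
      by (intro sum.cong refl) (auto simp: H_def sym)
    finally have sw: "(\<Sum>a<n. \<Sum>b<n. H a b * (cmod (d b))\<^sup>2) = (\<Sum>a<n. \<Sum>b<n. H a b * (cmod (d a))\<^sup>2)" .
    have "\<delta> * (\<Sum>a<n. (cmod (d a))\<^sup>2) \<le> (\<Sum>a<n. s a * (cmod (d a))\<^sup>2)"
      unfolding sum_distrib_left using \<delta> by (intro sum_mono mult_right_mono) auto
    also have "\<dots> = - (\<Sum>a<n. \<Sum>b<n. H a b * (cmod (d a))\<^sup>2)"
      by (simp add: s_def sum_distrib_right sum_negf)
    also have "\<dots> = (\<Sum>a<n. \<Sum>b<n. - (H a b * ((cmod (d a))\<^sup>2 + (cmod (d b))\<^sup>2) / 2))"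
      using sw by (simp add: algebra_simps sum.distrib sum_negf sum_subtractf add_divide_distrib flip: sum_divide_distrib)
    also have "\<dots> \<le> (\<Sum>a<n. \<Sum>b<n. G a b * Re (d b * cnj (d a)))"
    proof (intro sum_mono)
      fix a b
      have *: "\<bar>Re (d b * cnj (d a))\<bar> \<le> ((cmod (d a))\<^sup>2 + (cmod (d b))\<^sup>2) / 2"
        using abs_Re_le_cmod[of "d b * cnj (d a)"] sum_squares_bound[of "cmod (d a)" "cmod (d b)"]
        by (simp add: norm_mult algebra_simps)
      show "- (H a b * ((cmod (d a))\<^sup>2 + (cmod (d b))\<^sup>2) / 2) \<le> G a b * Re (d b * cnj (d a))"
      proof (cases "a = b")
        case True
        then show ?thesis by (simp add: H_def complex_mult_cnj cmod_power2 field_simps)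
      next
        case False
        have "- (G a b * Re (d b * cnj (d a))) \<le> \<bar>G a b\<bar> * \<bar>Re (d b * cnj (d a))\<bar>"
          by (metis abs_ge_minus_self abs_mult)
        also have "\<dots> \<le> \<bar>G a b\<bar> * (((cmod (d a))\<^sup>2 + (cmod (d b))\<^sup>2) / 2)"
          using * by (intro mult_left_mono) auto
        finally show ?thesis using False by (simp add: H_def)
      qed
    qed
    finally show ?thesis .
  qed
  then show ?thesis using \<delta> by blast
qed

section \<open>Voltages bounded by voltage drops\<close>

definition drop_energy :: "(nat \<times> nat) set \<Rightarrow> (nat \<Rightarrow> complex) \<Rightarrow> real" where
  "drop_energy E x = (\<Sum>(j, k)\<in>E. \<Sum>a<3. (cmod (voltage_drop x j k a))\<^sup>2)"

text \<open>Induction along a walk from the slack bus, where x vanishes. Crossing one more line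
  gives |x_k|^2 <= 2 |x_j|^2 + 2 |x_j - x_k|^2 in each phase, and the last term is part of the
  energy, so K becomes 2 K + 2.\<close>

lemma bus_le_drop_energy:
  assumes "finite E" and "(0, j) \<in> E\<^sup>*"
  shows "\<exists>K\<ge>0. \<forall>x. (\<forall>a<3. x a = 0) \<longrightarrow> (\<Sum>a<3. (cmod (x (3 * j + a)))\<^sup>2) \<le> K * drop_energy E x"
  using assms(2)
proof (induction rule: rtrancl_induct)
  case base
  show ?case by (rule exI[of _ 0]) simp
next
  case (step j k)
  then obtain K where K: "K \<ge> 0"
    "\<And>x. \<forall>a<3. x a = 0 \<Longrightarrow> (\<Sum>a<3. (cmod (x (3 * j + a)))\<^sup>2) \<le> K * drop_energy E x"
    by blast
  have "(\<Sum>a<3. (cmod (x (3 * k + a)))\<^sup>2) \<le> (2 * K + 2) * drop_energy E x" if "\<forall>a<3. x a = 0" for x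
  proof -
    have "(cmod (x (3 * k + a)))\<^sup>2
       \<le> 2 * (cmod (x (3 * j + a)))\<^sup>2 + 2 * (cmod (voltage_drop x j k a))\<^sup>2" for a
    proof -
      have "cmod (x (3 * k + a)) \<le> cmod (x (3 * j + a)) + cmod (voltage_drop x j k a)"
        unfolding voltage_drop_def using norm_triangle_sub[of "x (3 * k + a)" "x (3 * j + a)"]
        by (simp add: norm_minus_commute)
      then have "(cmod (x (3 * k + a)))\<^sup>2 \<le> (cmod (x (3 * j + a)) + cmod (voltage_drop x j k a))\<^sup>2"
        by (simp add: power_mono)
      also have "\<dots> \<le> 2 * (cmod (x (3 * j + a)))\<^sup>2 + 2 * (cmod (voltage_drop x j k a))\<^sup>2"
        using sum_squares_bound[of "cmod (x (3 * j + a))" "cmod (voltage_drop x j k a)"]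
        by (simp add: power2_sum)
      finally show ?thesis .
    qed
    then have "(\<Sum>a<3. (cmod (x (3 * k + a)))\<^sup>2)
       \<le> (\<Sum>a<3. 2 * (cmod (x (3 * j + a)))\<^sup>2 + 2 * (cmod (voltage_drop x j k a))\<^sup>2)"
      by (rule sum_mono)
    also have "\<dots> = 2 * (\<Sum>a<3. (cmod (x (3 * j + a)))\<^sup>2) + 2 * (\<Sum>a<3. (cmod (voltage_drop x j k a))\<^sup>2)"
      by (simp only: sum.distrib sum_distrib_left)
    also have "(\<Sum>a<3. (cmod (voltage_drop x j k a))\<^sup>2) \<le> drop_energy E x"
      unfolding drop_energy_def
      using member_le_sum[of "(j, k)" E "\<lambda>(j, k). \<Sum>a<3. (cmod (voltage_drop x j k a))\<^sup>2"] step.hyps assms(1)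
      by (auto simp: sum_nonneg)
    finally show ?thesis using K(2)[OF that] by (simp add: algebra_simps)
  qed
  then show ?case using K(1) by (intro exI[of _ "2 * K + 2"]) simp
qed

text \<open>A discrete Poincare inequality, obtained by adding the bounds of all buses. The extra 1
  in the constant makes it positive, so that it can be divided by later.\<close>

lemma sqnorm_le_drop_energy:
  assumes "finite E" and conn: "\<And>j. j \<le> N \<Longrightarrow> (0, j) \<in> E\<^sup>*"
  shows "\<exists>K>0. \<forall>x. (\<forall>a<3. x a = 0) \<longrightarrow> sqnorm (3 * (N + 1)) x \<le> K * drop_energy E x"
proof -
  have "\<forall>j\<in>{..<N+1}. \<exists>K\<ge>0. \<forall>x. (\<forall>a<3. x a = 0) \<longrightarrow>
      (\<Sum>a<3. (cmod (x (3 * j + a)))\<^sup>2) \<le> K * drop_energy E x"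
    using bus_le_drop_energy[OF assms(1) conn] by simp
  then obtain K where K: "\<And>j. j < N + 1 \<Longrightarrow> K j \<ge> 0"
    "\<And>j x. j < N + 1 \<Longrightarrow> \<forall>a<3. x a = 0 \<Longrightarrow> (\<Sum>a<3. (cmod (x (3 * j + a)))\<^sup>2) \<le> K j * drop_energy E x"
    unfolding bchoice_iff by auto
  have "sqnorm (3 * (N + 1)) x \<le> ((\<Sum>j<N+1. K j) + 1) * drop_energy E x" if "\<forall>a<3. x a = 0" for x
  proof -
    have "sqnorm (3 * (N + 1)) x \<le> (\<Sum>j<N+1. K j * drop_energy E x)"
      unfolding sqnorm_def sum_buses using K(2) that by (intro sum_mono) auto
    also have "\<dots> = (\<Sum>j<N+1. K j) * drop_energy E x"
      by (simp only: sum_distrib_right)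
    also have "\<dots> \<le> ((\<Sum>j<N+1. K j) + 1) * drop_energy E x"
      by (intro mult_right_mono) (auto simp: drop_energy_def intro!: sum_nonneg)
    finally show ?thesis .
  qed
  moreover have "0 < (\<Sum>j<N+1. K j) + 1"
    using sum_nonneg[of "{..<N+1}" K] K(1) by force
  ultimately show ?thesis by blast
qed

section \<open>Simple paths and the cut defined by a line of a tree\<close>

lemma rtrancl_imp_path:
  assumes "(a, b) \<in> R\<^sup>*"
  shows "\<exists>vs. vs \<noteq> [] \<and> distinct vs \<and> hd vs = a \<and> last vs = b \<and>
    (\<forall>i. Suc i < length vs \<longrightarrow> (vs ! i, vs ! Suc i) \<in> R)"
  using assms
proof (induction rule: rtrancl_induct)
  case base
  show ?case by (rule exI[of _ "[a]"]) simp
next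
  case (step b c)
  then obtain vs where vs: "vs \<noteq> []" "distinct vs" "hd vs = a" "last vs = b"
    "\<And>i. Suc i < length vs \<Longrightarrow> (vs ! i, vs ! Suc i) \<in> R"
    by blast
  show ?case
  proof (cases "c \<in> set vs")
    \<comment> \<open>A repeated vertex is handled by cutting the path off at its first visit, which
      keeps the vertices distinct.\<close>
    case True
    then obtain m where m: "m < length vs" "vs ! m = c" by (auto simp: in_set_conv_nth)
    then have "last (take (Suc m) vs) = c"
      by (simp add: take_Suc_conv_app_nth)
    then show ?thesis
      by (intro exI[of _ "take (Suc m) vs"]) (use vs in auto)
  next
    case False
    have "((vs @ [c]) ! i, (vs @ [c]) ! Suc i) \<in> R" if "Suc i < length (vs @ [c])" for i
    proof (cases "Suc i < length vs")
      case True
      then show ?thesis using vs by (simp add: nth_append)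
    next
      case False
      then have "i = length vs - 1" "Suc i = length vs" using that vs(1) by auto
      then show ?thesis using step.hyps vs by (simp add: nth_append last_conv_nth)
    qed
    then show ?thesis
      using vs False by (intro exI[of _ "vs @ [c]"]) simp
  qed
qed

text \<open>Delete the line and let \<open>S\<close> be the set reachable from k. If j were
  reachable, a simple path from k to j would close up to a cycle through the deleted line. No
  remaining line leaves \<open>S\<close>, so only the deleted one crosses.\<close>

lemma tree_cut:
  assumes "tree_graph N E" and e: "(j, k) \<in> E"
  shows "\<exists>S. 0 \<notin> S \<and> (\<forall>p q. (p, q) \<in> E \<longrightarrow>
    ((p \<in> S) \<noteq> (q \<in> S) \<longleftrightarrow> (p, q) = (j, k) \<or> (p, q) = (k, j)))"
proof -
  have sym: "sym E" and irr: "irrefl E" and acyc: "\<not> is_cycle E vs" for vs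
    using assms by (auto simp: tree_graph_def simple_graph_def)
  define R where "R = E - {(j, k), (k, j)}"
  define S where "S = {v. (k, v) \<in> R\<^sup>*}"
  have jk: "j \<noteq> k" using e irr by (auto simp: irrefl_def)
  have "j \<notin> S"
  proof
    assume "j \<in> S"
    then obtain vs where vs: "vs \<noteq> []" "distinct vs" "hd vs = k" "last vs = j"
      "\<And>i. Suc i < length vs \<Longrightarrow> (vs ! i, vs ! Suc i) \<in> R"
      using rtrancl_imp_path[of k j R] by (auto simp: S_def)
    \<comment> \<open>A cycle needs three vertices: length 1 would mean j = k, and length 2 would
      use the deleted line.\<close>
    have "length vs \<noteq> 1"
      using vs jk by (auto simp: length_Suc_conv)
    moreover have "length vs \<noteq> 2"
    proof
      assume "length vs = 2"
      then have "(k, j) \<in> R"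
        using vs(5)[of 0] vs by (simp add: hd_conv_nth last_conv_nth numeral_2_eq_2)
      then show False by (simp add: R_def)
    qed
    ultimately have "3 \<le> length vs"
      using vs(1) by (cases "length vs") (auto simp: not_less_eq_eq eval_nat_numeral le_Suc_eq)
    then have "is_cycle E vs"
      using vs e by (auto simp: is_cycle_def R_def)
    then show False using acyc by blast
  qed
  moreover have "k \<in> S" by (simp add: S_def)
  moreover have "p \<in> S \<longleftrightarrow> q \<in> S" if "(p, q) \<in> R" for p q
  proof -
    have "(q, p) \<in> R" using that sym by (auto simp: R_def dest: symD)
    then show ?thesis using that by (auto simp: S_def intro: rtrancl_into_rtrancl)
  qed
  ultimately have "(p \<in> S) \<noteq> (q \<in> S) \<longleftrightarrow> (p, q) = (j, k) \<or> (p, q) = (k, j)" if "(p, q) \<in> E" for p q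
    using that by (auto simp: R_def)
  \<comment> \<open>Complementing does not change which lines cross, so the side without the slack
    bus can be taken.\<close>
  then show ?thesis
    by (intro exI[of _ "if 0 \<in> S then - S else S"]) auto
qed

section \<open>Sign of the loss form off the slack bus\<close>

lemma negative_conductance_form:
  assumes tree: "tree_graph N E" and y: "line_admittances E y"
    and e: "(j, k) \<in> E" and r: "r < 3" "Re (y j k $$ (r, r)) < 0"
  shows "\<exists>x. (\<forall>a<3. x a = 0) \<and> Re (sform (3 * (N + 1)) (Ymat N E y) x x) < 0"
proof -
  have g: "simple_graph N E" using tree by (simp add: tree_graph_def)
  have fin: "finite E" and sym: "sym E" and irr: "irrefl E"
    using g simple_graph_finite by (auto simp: simple_graph_def)
  obtain S where S: "0 \<notin> S" and cut: "\<And>p q. (p, q) \<in> E \<Longrightarrow>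
    ((p \<in> S) \<noteq> (q \<in> S) \<longleftrightarrow> (p, q) = (j, k) \<or> (p, q) = (k, j))"
    using tree_cut[OF tree e] by blast
  \<comment> \<open>A unit voltage in phase r on the side \<open>S\<close> of the cut: the drop is 1
    or -1 on the line between j and k in phase r, and zero everywhere else.\<close>
  define x :: "nat \<Rightarrow> complex" where "x i = of_bool (i div 3 \<in> S \<and> i mod 3 = r)" for i
  define \<chi> :: "nat \<Rightarrow> nat \<Rightarrow> complex" where "\<chi> p q = of_bool (p \<in> S) - of_bool (q \<in> S)" for p q
  have drop: "voltage_drop x p q a = (if a = r then \<chi> p q else 0)" if "a < 3" for p q a
    using that by (auto simp: voltage_drop_def x_def \<chi>_def)
  have form: "edge_form (y p q) (voltage_drop x p q) = y p q $$ (r, r) * (\<chi> p q * cnj (\<chi> p q))" for p q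
    using r(1) by (auto simp: edge_form_def drop eval_nat_numeral less_Suc_eq)
  have \<chi>0: "\<chi> p q = 0" if "(p, q) \<in> E" "(p, q) \<notin> {(j, k), (k, j)}" for p q
    using cut[OF that(1)] that(2) by (cases "p \<in> S"; cases "q \<in> S"; simp add: \<chi>_def)
  have jk: "j \<noteq> k" using e irr by (auto simp: irrefl_def)
  have ykj: "y k j = y j k" using y e by (auto simp: line_admittances_def)
  have "2 * sform (3 * (N + 1)) (Ymat N E y) x x
     = (\<Sum>(p, q)\<in>E. y p q $$ (r, r) * (\<chi> p q * cnj (\<chi> p q)))"
    unfolding sform_Ymat[OF g y] form ..
  also have "\<dots> = (\<Sum>(p, q)\<in>{(j, k), (k, j)}. y p q $$ (r, r) * (\<chi> p q * cnj (\<chi> p q)))"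
  proof (rule sum.mono_neutral_right)
    show "{(j, k), (k, j)} \<subseteq> E" using e sym by (auto dest: symD)
    show "\<forall>e\<in>E - {(j, k), (k, j)}. (case e of (p, q) \<Rightarrow> y p q $$ (r, r) * (\<chi> p q * cnj (\<chi> p q))) = 0"
    proof
      fix e assume "e \<in> E - {(j, k), (k, j)}"
      then have "\<chi> (fst e) (snd e) = 0" by (intro \<chi>0) auto
      then show "(case e of (p, q) \<Rightarrow> y p q $$ (r, r) * (\<chi> p q * cnj (\<chi> p q))) = 0"
        by (simp add: case_prod_unfold)
    qed
  qed (rule fin)
  also have "\<dots> = 2 * y j k $$ (r, r)"
    using jk cut[OF e] ykj by (auto simp: \<chi>_def)
  finally have "Re (sform (3 * (N + 1)) (Ymat N E y) x x) < 0"
    using r(2) by simp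
  moreover have "\<forall>a<3. x a = 0"
    using S by (simp add: x_def)
  ultimately show ?thesis by blast
qed

text \<open>Diagonal dominance bounds each line form below by a multiple of the squared drop; the
  least multiple over the finitely many lines combines with \<open>sqnorm_le_drop_energy\<close>.
  The 2 in the final constant comes from \<open>sform_Ymat\<close>.\<close>

lemma positive_conductance_form:
  assumes tree: "tree_graph N E" and y: "line_admittances E y"
    and sym: "\<And>j k. (j, k) \<in> E \<Longrightarrow> y j k = transpose_mat (y j k)"
    and dom: "\<And>j k. (j, k) \<in> E \<Longrightarrow> strictly_diag_dominant (map_mat Re (y j k))"
    and pos: "\<And>j k r. (j, k) \<in> E \<Longrightarrow> r < 3 \<Longrightarrow> 0 \<le> Re (y j k $$ (r, r))"
  shows "\<exists>c>0. \<forall>x. (\<forall>a<3. x a = 0) \<longrightarrow>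
    c * sqnorm (3 * (N + 1)) x \<le> Re (sform (3 * (N + 1)) (Ymat N E y) x x)"
proof -
  have g: "simple_graph N E" using tree by (simp add: tree_graph_def)
  note fin = simple_graph_finite[OF g]
  have "\<forall>e\<in>E. \<exists>\<delta>>0. \<forall>d. \<delta> * (\<Sum>a<3. (cmod (d a))\<^sup>2) \<le> Re (edge_form (y (fst e) (snd e)) d)"
  proof
    fix e assume "e \<in> E"
    then obtain j k where e: "e = (j, k)" "(j, k) \<in> E" by (cases e) auto
    have c: "y j k \<in> carrier_mat 3 3" using y e by (auto simp: line_admittances_def)
    have "(\<Sum>b\<in>{..<3} - {a}. \<bar>Re (y j k $$ (a, b))\<bar>) < Re (y j k $$ (a, a))" if "a < 3" for a
    proof -
      have "(\<Sum>b\<in>{..<3} - {a}. \<bar>map_mat Re (y j k) $$ (a, b)\<bar>) < \<bar>map_mat Re (y j k) $$ (a, a)\<bar>"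
        using dom[OF e(2)] c that unfolding strictly_diag_dominant_def by auto
      also have "(\<Sum>b\<in>{..<3} - {a}. \<bar>map_mat Re (y j k) $$ (a, b)\<bar>) = (\<Sum>b\<in>{..<3} - {a}. \<bar>Re (y j k $$ (a, b))\<bar>)"
        using c that by (intro sum.cong) auto
      \<comment> \<open>Dominance compares with the absolute value of the diagonal entry;
        nonnegativity removes that absolute value.\<close>
      finally show ?thesis using c that pos[OF e(2) that] by simp
    qed
    moreover have "Re (y j k $$ (a, b)) = Re (y j k $$ (b, a))" if "a < 3" "b < 3" for a b
      using c that by (subst sym[OF e(2)]) simp
    ultimately obtain \<delta> where "\<delta> > 0" "\<And>d. \<delta> * (\<Sum>a<3. (cmod (d a))\<^sup>2)
        \<le> (\<Sum>a<3. \<Sum>b<3. Re (y j k $$ (a, b)) * Re (d b * cnj (d a)))"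
      using diag_dominant_form_lower_bound[of 3 "\<lambda>a b. Re (y j k $$ (a, b))"] by blast
    then show "\<exists>\<delta>>0. \<forall>d. \<delta> * (\<Sum>a<3. (cmod (d a))\<^sup>2) \<le> Re (edge_form (y (fst e) (snd e)) d)"
      unfolding e fst_conv snd_conv Re_edge_form[OF c sym[OF e(2)]] by blast
  qed
  then obtain D where D: "\<And>e. e \<in> E \<Longrightarrow> 0 < D e"
    "\<And>j k d. (j, k) \<in> E \<Longrightarrow> D (j, k) * (\<Sum>a<3. (cmod (d a))\<^sup>2) \<le> Re (edge_form (y j k) d)"
    unfolding bchoice_iff by force
  obtain \<delta> where \<delta>: "\<delta> > 0" "\<And>e. e \<in> E \<Longrightarrow> \<delta> \<le> D e"
    using finite_pos_lower_bound[OF fin, of D] D(1) by blast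
  have energy: "\<delta> / 2 * drop_energy E x \<le> Re (sform (3 * (N + 1)) (Ymat N E y) x x)" for x
  proof -
    have "\<delta> * drop_energy E x \<le> (\<Sum>(j, k)\<in>E. Re (edge_form (y j k) (voltage_drop x j k)))"
      unfolding drop_energy_def sum_distrib_left
    proof (intro sum_mono, clarify)
      fix j k assume e: "(j, k) \<in> E"
      have "\<delta> * (\<Sum>a<3. (cmod (voltage_drop x j k a))\<^sup>2) \<le> D (j, k) * (\<Sum>a<3. (cmod (voltage_drop x j k a))\<^sup>2)"
        using \<delta>(2)[OF e] by (intro mult_right_mono sum_nonneg) auto
      also have "\<dots> \<le> Re (edge_form (y j k) (voltage_drop x j k))"
        by (rule D(2)[OF e])
      finally show "\<delta> * (\<Sum>a<3. (cmod (voltage_drop x j k a))\<^sup>2) \<le> Re (edge_form (y j k) (voltage_drop x j k))" .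
    qed
    also have "\<dots> = Re (2 * sform (3 * (N + 1)) (Ymat N E y) x x)"
      unfolding sform_Ymat[OF g y] by (simp add: case_prod_unfold)
    finally show ?thesis by simp
  qed
  have "\<And>j. j \<le> N \<Longrightarrow> (0, j) \<in> E\<^sup>*" using tree by (auto simp: tree_graph_def)
  then obtain K where K: "K > 0"
    "\<And>x. \<forall>a<3. x a = 0 \<Longrightarrow> sqnorm (3 * (N + 1)) x \<le> K * drop_energy E x"
    using sqnorm_le_drop_energy[OF fin, of N] by blast
  have "\<delta> / (2 * K) * sqnorm (3 * (N + 1)) x \<le> Re (sform (3 * (N + 1)) (Ymat N E y) x x)"
    if "\<forall>a<3. x a = 0" for x
  proof -
    have "\<delta> / (2 * K) * sqnorm (3 * (N + 1)) x \<le> \<delta> / (2 * K) * (K * drop_energy E x)"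
      using K \<delta>(1) that by (intro mult_left_mono) auto
    also have "\<dots> = \<delta> / 2 * drop_energy E x" using K(1) by simp
    finally show ?thesis using energy[of x] by simp
  qed
  then show ?thesis using K(1) \<delta>(1) by (intro exI[of _ "\<delta> / (2 * K)"]) auto
qed

section \<open>Perturbation of feasible points\<close>

lemma Emat_carrier: "Emat N j \<phi> \<in> carrier_mat (3 * (N + 1)) (3 * (N + 1))"
  by (simp add: Emat_def outer_def)

lemma Ymat_at_carrier: "Ymat_at N E y j \<phi> \<in> carrier_mat (3 * (N + 1)) (3 * (N + 1))"
  unfolding Ymat_at_def by (rule mult_carrier_mat[OF Emat_carrier Ymat_carrier])

lemma Pmat_carrier: "Pmat N E y j \<phi> \<in> carrier_mat (3 * (N + 1)) (3 * (N + 1))"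
  unfolding Pmat_def using mat_adjoint_carrier[OF Ymat_at_carrier] Ymat_at_carrier
  by (intro smult_carrier_mat add_carrier_mat)

lemma Qmat_carrier: "Qmat N E y j \<phi> \<in> carrier_mat (3 * (N + 1)) (3 * (N + 1))"
  unfolding Qmat_def using Ymat_at_carrier by (intro smult_carrier_mat minus_carrier_mat)

lemma Cmat_carrier: "Cmat N E y \<in> carrier_mat (3 * (N + 1)) (3 * (N + 1))"
  unfolding Cmat_def using mat_adjoint_carrier[OF Ymat_carrier] by (intro smult_carrier_mat add_carrier_mat)

section \<open>A uniform bound for the constraint matrices\<close>

definition entry_sum :: "nat \<Rightarrow> complex mat \<Rightarrow> real" where
  "entry_sum n A = (\<Sum>i<n. \<Sum>j<n. cmod (A $$ (i, j)))"

lemma entry_sum_nonneg: "0 \<le> entry_sum n A"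
  by (simp add: entry_sum_def sum_nonneg)

text \<open>A common bound for the constraint matrices of all buses and phases. It is built from the
  network alone, which keeps the threshold independent of the limits, the slack voltage and
  u.\<close>

definition sensitivity :: "nat \<Rightarrow> (nat \<times> nat) set \<Rightarrow> (nat \<Rightarrow> nat \<Rightarrow> complex mat) \<Rightarrow> real" where
  "sensitivity N E y = (\<Sum>j = 1..N. \<Sum>\<phi><3. entry_sum (3 * (N + 1)) (Pmat N E y j \<phi>)
     + entry_sum (3 * (N + 1)) (Qmat N E y j \<phi>) + entry_sum (3 * (N + 1)) (Emat N j \<phi>))"

lemma sensitivity_nonneg: "0 \<le> sensitivity N E y"
  by (auto simp: sensitivity_def entry_sum_nonneg intro!: sum_nonneg add_nonneg_nonneg)

lemma entry_sum_le_sensitivity: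
  assumes "j \<in> {1..N}" "\<phi> < 3" "M \<in> {Pmat N E y j \<phi>, Qmat N E y j \<phi>, Emat N j \<phi>}"
  shows "entry_sum (3 * (N + 1)) M \<le> sensitivity N E y"
proof -
  define g where "g j \<phi> = entry_sum (3 * (N + 1)) (Pmat N E y j \<phi>)
     + entry_sum (3 * (N + 1)) (Qmat N E y j \<phi>) + entry_sum (3 * (N + 1)) (Emat N j \<phi>)" for j \<phi>
  have g0: "0 \<le> g j \<phi>" for j \<phi>
    by (simp add: g_def entry_sum_nonneg)
  have "entry_sum (3 * (N + 1)) M \<le> g j \<phi>"
    using assms(3) entry_sum_nonneg[of "3 * (N + 1)"] unfolding g_def
    by (elim insertE emptyE) (auto intro: add_increasing add_increasing2 add_nonneg_nonneg)
  also have "\<dots> \<le> (\<Sum>\<phi><3. g j \<phi>)"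
    using assms g0 by (intro member_le_sum) auto
  also have "\<dots> \<le> (\<Sum>j = 1..N. \<Sum>\<phi><3. g j \<phi>)"
    using assms g0 by (intro member_le_sum[of j]) (auto intro: sum_nonneg)
  finally show ?thesis by (simp only: sensitivity_def g_def)
qed

section \<open>Effect of a perturbation on constraints and objective\<close>

lemma PE_feasible_perturb:
  assumes feas: "PE_feasible N E y L Vref NU u W z"
    and psd: "hermitian_psd (3 * (N + 1)) W'" and block: "block W' 0 0 = block W 0 0"
    and tr: "\<And>M. M \<in> carrier_mat (3 * (N + 1)) (3 * (N + 1)) \<Longrightarrow>
      tr (M * W') = tr (M * W) + of_real c * sform (3 * (N + 1)) M f f"
    and c: "\<bar>c\<bar> \<le> 1"
  shows "PE_feasible N E y L Vref NU u W'
    (\<lambda>k j \<phi>. z k j \<phi> + sensitivity N E y * sqnorm (3 * (N + 1)) f)"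
proof -
  define D where "D = sensitivity N E y * sqnorm (3 * (N + 1)) f"
  have sq: "0 \<le> sqnorm (3 * (N + 1)) f" by (simp add: sqnorm_def sum_nonneg)
  then have D: "0 \<le> D" using sensitivity_nonneg by (simp add: D_def)
  have bound: "\<bar>Re (tr (M * W')) - Re (tr (M * W))\<bar> \<le> D"
    if j: "j \<in> {1..N}" "\<phi> < 3" and M: "M \<in> {Pmat N E y j \<phi>, Qmat N E y j \<phi>, Emat N j \<phi>}" for M j \<phi>
  proof -
    have "M \<in> carrier_mat (3 * (N + 1)) (3 * (N + 1))"
      using M Pmat_carrier Qmat_carrier Emat_carrier by (elim insertE emptyE) simp_all
    from tr[OF this] have "\<bar>Re (tr (M * W')) - Re (tr (M * W))\<bar> = \<bar>c\<bar> * \<bar>Re (sform (3 * (N + 1)) M f f)\<bar>"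
      by (simp add: abs_mult)
    also have "\<dots> \<le> 1 * cmod (sform (3 * (N + 1)) M f f)"
      using c by (intro mult_mono abs_Re_le_cmod) auto
    also have "\<dots> \<le> entry_sum (3 * (N + 1)) M * sqnorm (3 * (N + 1)) f"
      using sform_bound by (simp add: entry_sum_def)
    also have "\<dots> \<le> D"
      unfolding D_def by (rule mult_right_mono[OF entry_sum_le_sensitivity[OF j M] sq])
    finally show ?thesis .
  qed
  have lim: "Re (tr (Pmat N E y j \<phi> * W)) - renewable NU u j \<phi> - p_max L j \<phi> \<le> z 1 j \<phi> \<and>
      - Re (tr (Pmat N E y j \<phi> * W)) + renewable NU u j \<phi> + p_min L j \<phi> \<le> z 2 j \<phi> \<and>
      Re (tr (Qmat N E y j \<phi> * W)) - q_max L j \<phi> \<le> z 3 j \<phi> \<and>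
      - Re (tr (Qmat N E y j \<phi> * W)) + q_min L j \<phi> \<le> z 4 j \<phi> \<and>
      Re (tr (Emat N j \<phi> * W)) - (V_max L j \<phi>)\<^sup>2 \<le> z 5 j \<phi> \<and>
      - Re (tr (Emat N j \<phi> * W)) + (V_min L j \<phi>)\<^sup>2 \<le> z 6 j \<phi>"
    if "j \<in> {1..N}" "\<phi> < 3" for j \<phi>
    using feas that unfolding PE_feasible_def by blast
  have nonneg: "0 \<le> z k j \<phi>" if "k \<in> {1..6}" "j \<in> {1..N}" "\<phi> < 3" for k j \<phi>
    using feas that unfolding PE_feasible_def by blast
  have "block W' 0 0 = outer Vref Vref"
    using feas block unfolding PE_feasible_def by simp
  moreover have "Re (tr (Pmat N E y j \<phi> * W')) - renewable NU u j \<phi> - p_max L j \<phi> \<le> z 1 j \<phi> + D \<and>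
      - Re (tr (Pmat N E y j \<phi> * W')) + renewable NU u j \<phi> + p_min L j \<phi> \<le> z 2 j \<phi> + D \<and>
      Re (tr (Qmat N E y j \<phi> * W')) - q_max L j \<phi> \<le> z 3 j \<phi> + D \<and>
      - Re (tr (Qmat N E y j \<phi> * W')) + q_min L j \<phi> \<le> z 4 j \<phi> + D \<and>
      Re (tr (Emat N j \<phi> * W')) - (V_max L j \<phi>)\<^sup>2 \<le> z 5 j \<phi> + D \<and>
      - Re (tr (Emat N j \<phi> * W')) + (V_min L j \<phi>)\<^sup>2 \<le> z 6 j \<phi> + D"
    if j: "j \<in> {1..N}" "\<phi> < 3" for j \<phi>
  proof -
    note b = bound[OF j, of "Pmat N E y j \<phi>"] bound[OF j, of "Qmat N E y j \<phi>"] bound[OF j, of "Emat N j \<phi>"]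
    show ?thesis
      using lim[OF j] b by (simp add: abs_le_iff)
  qed
  moreover have "0 \<le> z k j \<phi> + D" if "k \<in> {1..6}" "j \<in> {1..N}" "\<phi> < 3" for k j \<phi>
    using nonneg[OF that] D by simp
  ultimately show ?thesis
    using psd unfolding PE_feasible_def D_def by blast
qed

text \<open>The competitor raises every slack variable by the same amount, enough to absorb the
  change of any trace. Keeping c general covers both adding (c = 1) and subtracting (c = -1) a
  rank-one matrix.\<close>

lemma PE_optimal_perturb:
  assumes opt: "PE_optimal N E y L Vref NU \<beta> u W z"
    and psd: "hermitian_psd (3 * (N + 1)) W'" and block: "block W' 0 0 = block W 0 0"
    and tr: "\<And>M. M \<in> carrier_mat (3 * (N + 1)) (3 * (N + 1)) \<Longrightarrow>
      tr (M * W') = tr (M * W) + of_real c * sform (3 * (N + 1)) M f f"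
    and c: "\<bar>c\<bar> \<le> 1"
  shows "0 \<le> \<beta> * (18 * real N * sensitivity N E y) * sqnorm (3 * (N + 1)) f
    + c * Re (sform (3 * (N + 1)) (Ymat N E y) f f)"
proof -
  define D where "D = sensitivity N E y * sqnorm (3 * (N + 1)) f"
  have feas: "PE_feasible N E y L Vref NU u W z"
    using opt by (simp add: PE_optimal_def)
  have "PE_objective N E y \<beta> W z \<le> PE_objective N E y \<beta> W' (\<lambda>k j \<phi>. z k j \<phi> + D)"
    using opt PE_feasible_perturb[OF feas psd block tr c] by (simp add: PE_optimal_def D_def)
  also have "\<dots> = PE_objective N E y \<beta> W z + \<beta> * (18 * real N * D)
      + c * Re (sform (3 * (N + 1)) (Ymat N E y) f f)"
  proof -
    \<comment> \<open>18 counts six constraints for each of three phases.\<close>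
    have "(\<Sum>k = 1..6. \<Sum>j = 1..N. \<Sum>\<phi><3. z k j \<phi> + D)
        = (\<Sum>k = 1..6. \<Sum>j = 1..N. \<Sum>\<phi><3. z k j \<phi>) + 18 * real N * D"
      by (simp add: sum.distrib)
    moreover have "Re (tr (Cmat N E y * W'))
        = Re (tr (Cmat N E y * W)) + c * Re (sform (3 * (N + 1)) (Ymat N E y) f f)"
      unfolding tr[OF Cmat_carrier] using Re_sform_Cmat[of N E y f] by simp
    ultimately show ?thesis
      unfolding PE_objective_def by (simp only: distrib_left)
  qed
  finally show ?thesis by (simp add: D_def algebra_simps)
qed

lemma block_add_outer:
  assumes "X \<in> carrier_mat n n" "x \<in> carrier_vec n" "3 \<le> n" "\<forall>a<3. x $ a = 0"
  shows "block (X + outer x x) 0 0 = block X 0 0" and "block (X - outer x x) 0 0 = block X 0 0"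
  using assms by (auto simp: block_def intro!: cong_mat)

lemma sum_slack:
  fixes g h :: "nat \<Rightarrow> complex"
  assumes "3 \<le> (n::nat)"
  shows "(\<Sum>k<n. g k * (if k < 3 then h k else 0)) = (\<Sum>k<3. g k * h k)"
proof -
  have "(\<Sum>k<3. g k * h k) = (\<Sum>k<3. g k * (if k < 3 then h k else 0))"
    by (intro sum.cong) auto
  also have "\<dots> = (\<Sum>k<n. g k * (if k < 3 then h k else 0))"
    using assms by (intro sum.mono_neutral_left) auto
  finally show ?thesis ..
qed

text \<open>
  Since the slack block has rank one, the Schur complement of \<open>W\<close> along the slack voltage has zero
  slack block; unless it vanishes, a rank-one matrix living off the slack bus can be removed from it.
\<close>

lemma slack_rank_one_or_deflate:
  assumes psd: "hermitian_psd n W" and n: "3 \<le> n" and blk: "block W 0 0 = outer Vref Vref"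
    and Vref: "Vref \<in> carrier_vec 3" "Vref \<noteq> 0\<^sub>v 3"
  obtains V where "V \<in> carrier_vec n" "W = outer V V" "vec 3 (\<lambda>a. V $ a) = Vref"
  | x where "x \<in> carrier_vec n" "\<forall>a<3. x $ a = 0" "0 < sqnorm n (\<lambda>i. x $ i)"
      "hermitian_psd n (W - outer x x)"
proof -
  have W: "W \<in> carrier_mat n n" using psd by (simp add: hermitian_psd_iff)
  have Wab: "W $$ (a, b) = Vref $ a * cnj (Vref $ b)" if "a < 3" "b < 3" for a b
  proof -
    have "W $$ (a, b) = block W 0 0 $$ (a, b)" using that by (simp add: block_def)
    then show ?thesis using that Vref by (simp add: blk)
  qed
  define s where "s = (\<Sum>a<3. (cmod (Vref $ a))\<^sup>2)"
  obtain a where "a < 3" "Vref $ a \<noteq> 0"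
    using Vref by (metis carrier_vecD eq_vecI index_zero_vec)
  then have s: "0 < s"
    unfolding s_def by (intro sum_pos2[of _ a]) auto
  have s_eq: "(\<Sum>a<3. cnj (Vref $ a) * Vref $ a) = of_real s"
    by (simp add: s_def mult.commute flip: complex_norm_square)
  define v where "v k = (if k < 3 then Vref $ k else 0)" for k
  have Wv: "(\<Sum>k<n. W $$ (a, k) * v k) = Vref $ a * of_real s" if "a < 3" for a
    unfolding v_def sum_slack[OF n] using that s_eq
    by (simp add: Wab mult.assoc flip: sum_distrib_left)
  have "sform n W v v = (\<Sum>i<n. (\<Sum>k<n. W $$ (i, k) * v k) * (if i < 3 then cnj (Vref $ i) else 0))"
    unfolding sform_def sum_distrib_right by (intro sum.cong refl) (simp add: v_def)
  also have "\<dots> = (\<Sum>i<3. (Vref $ i * of_real s) * cnj (Vref $ i))"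
    unfolding sum_slack[OF n] by (intro sum.cong refl) (simp add: Wv)
  also have "\<dots> = of_real s * (\<Sum>a<3. cnj (Vref $ a) * Vref $ a)"
    by (simp add: sum_distrib_left mult_ac)
  also have "\<dots> = of_real (s\<^sup>2)" by (simp add: s_eq power2_eq_square)
  finally have b: "s\<^sup>2 = Re (sform n W v v)" by simp
  \<comment> \<open>As sqrt (s^2) = s, this is W v / s, and by \<open>Wv\<close> its slack entries
    are exactly those of \<open>Vref\<close>.\<close>
  define V where "V = vec n (\<lambda>i. (\<Sum>k<n. W $$ (i, k) * v k) / of_real (sqrt (s\<^sup>2)))"
  have V: "V \<in> carrier_vec n" by (simp add: V_def)
  have Va: "V $ a = Vref $ a" if "a < 3" for a
    using that n s by (simp add: V_def Wv)
  then have Vs: "vec 3 (\<lambda>a. V $ a) = Vref" using Vref by auto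
  define W0 where "W0 = W - outer V V"
  have psd0: "hermitian_psd n W0"
    unfolding W0_def by (rule hermitian_psd_deflate[OF psd b _ V_def]) (use s in simp)
  then have W0: "W0 \<in> carrier_mat n n" by (simp add: hermitian_psd_iff)
  \<comment> \<open>The slack block of \<open>W0\<close> is zero, and a zero diagonal entry of a
    positive semidefinite matrix clears its whole row.\<close>
  have slack0: "W0 $$ (a, k) = 0" if "a < 3" "k < n" for a k
  proof -
    have "W0 $$ (a, a) = 0" using that n W V by (simp add: W0_def Wab Va)
    then show ?thesis
      using hermitian_psd_diag_zero(2)[OF psd0 that(2), of a] that n by simp
  qed
  show thesis
  proof (cases "\<exists>i<n. Re (W0 $$ (i, i)) \<noteq> 0")
    case False
    then have W0z: "W0 $$ (i, j) = 0" if "i < n" "j < n" for i j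
      using hermitian_psd_diag_zero(1)[OF psd0 that] that by blast
    have "W = outer V V"
    proof (rule eq_matI)
      fix i j assume "i < dim_row (outer V V)" "j < dim_col (outer V V)"
      then have "i < n" "j < n" using V by auto
      then show "W $$ (i, j) = outer V V $$ (i, j)"
        using W0z[of i j] W V by (simp add: W0_def)
    qed (use W V in auto)
    then show ?thesis using V Vs that(1) by blast
  next
    case True
    then obtain i where i: "i < n" "Re (W0 $$ (i, i)) \<noteq> 0" by blast
    define b' where "b' = Re (sform n W0 (\<lambda>k. of_bool (k = i)) (\<lambda>k. of_bool (k = i)))"
    have b'_eq: "b' = Re (W0 $$ (i, i))" using i by (simp add: b'_def sform_indicator)
    have "0 \<le> b'" unfolding b'_def using psd0 by (simp add: hermitian_psd_iff)
    then have b': "0 < b'" using i b'_eq by simp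
    \<comment> \<open>A scaled column of \<open>W0\<close>, so it inherits the zeros in the slack
      rows.\<close>
    define x where "x = vec n (\<lambda>r. (\<Sum>k<n. W0 $$ (r, k) * of_bool (k = i)) / of_real (sqrt b'))"
    have x: "x \<in> carrier_vec n" by (simp add: x_def)
    have xr: "x $ r = W0 $$ (r, i) / of_real (sqrt b')" if "r < n" for r
    proof -
      have "(\<Sum>k<n. W0 $$ (r, k) * of_bool (k = i)) = (\<Sum>k<n. if k = i then W0 $$ (r, k) else 0)"
        by (intro sum.cong) auto
      then show ?thesis using that i by (simp add: x_def)
    qed
    have "x $ i \<noteq> 0" using xr[OF i(1)] i b' by auto
    then have "0 < sqnorm n (\<lambda>i. x $ i)"
      unfolding sqnorm_def using i by (intro sum_pos2[of _ i]) auto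
    moreover have "\<forall>a<3. x $ a = 0"
      using xr slack0 i n by simp
    moreover have "hermitian_psd n (W - outer x x)"
    proof -
      have "hermitian_psd n (W0 - outer x x)"
        by (rule hermitian_psd_deflate[OF psd0 b'_def b' x_def])
      \<comment> \<open>Deflation was applied to \<open>W0\<close>; adding V V^H back carries it
        over to \<open>W\<close>.\<close>
      then have "hermitian_psd n ((W0 - outer x x) + outer V V)"
        using hermitian_psd_outer[OF V] by (rule hermitian_psd_add)
      also have "(W0 - outer x x) + outer V V = W - outer x x"
        using W V x by (intro eq_matI) (auto simp: W0_def)
      finally show ?thesis .
    qed
    ultimately show ?thesis using x that(2) by blast
  qed
qed

text \<open>If x x^H could be removed, the loss would drop by at least c |x|^2 while the penalty
  would rise by strictly less, contradicting optimality. Only the rank-one alternative of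
  \<open>slack_rank_one_or_deflate\<close> remains.\<close>

lemma PE_optimal_rank_one:
  assumes pos: "\<And>x. \<forall>a<3. x a = 0 \<Longrightarrow>
      c * sqnorm (3 * (N + 1)) x \<le> Re (sform (3 * (N + 1)) (Ymat N E y) x x)"
    and \<beta>: "\<beta> * (18 * real N * sensitivity N E y) < c"
    and Vref: "Vref \<in> carrier_vec 3" "Vref \<noteq> 0\<^sub>v 3"
    and opt: "PE_optimal N E y L Vref NU \<beta> u W z"
  shows "\<exists>V \<in> carrier_vec (3 * (N + 1)). W = outer V V \<and> vec 3 (\<lambda>a. V $ a) = Vref"
proof -
  let ?n = "3 * (N + 1)"
  have n: "3 \<le> ?n" by simp
  have psd: "hermitian_psd ?n W" and blk: "block W 0 0 = outer Vref Vref"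
    using opt by (auto simp: PE_optimal_def PE_feasible_def)
  have W: "W \<in> carrier_mat ?n ?n" using psd unfolding hermitian_psd_iff by blast
  show ?thesis
  proof (rule slack_rank_one_or_deflate[OF psd n blk Vref])
    fix V assume "V \<in> carrier_vec ?n" "W = outer V V" "vec 3 (\<lambda>a. V $ a) = Vref"
    then show ?thesis by blast
  next
    fix x assume deflate: "x \<in> carrier_vec ?n" "\<forall>a<3. x $ a = 0" "0 < sqnorm ?n (\<lambda>i. x $ i)"
      "hermitian_psd ?n (W - outer x x)"
    have "tr (M * (W - outer x x)) = tr (M * W) + of_real (- 1) * sform ?n M (\<lambda>i. x $ i) (\<lambda>i. x $ i)"
      if "M \<in> carrier_mat ?n ?n" for M
      using tr_mult_diff[OF that W outer_carrier[OF deflate(1,1)]] tr_mult_outer[OF that deflate(1)] by simp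
    from PE_optimal_perturb[OF opt deflate(4) block_add_outer(2)[OF W deflate(1) n deflate(2)] this]
    have "Re (sform ?n (Ymat N E y) (\<lambda>i. x $ i) (\<lambda>i. x $ i))
        \<le> \<beta> * (18 * real N * sensitivity N E y) * sqnorm ?n (\<lambda>i. x $ i)" by simp
    also have "\<dots> < c * sqnorm ?n (\<lambda>i. x $ i)"
      using \<beta> deflate(3) by (rule mult_strict_right_mono)
    also have "\<dots> \<le> Re (sform ?n (Ymat N E y) (\<lambda>i. x $ i) (\<lambda>i. x $ i))"
      using pos deflate(2) by blast
    finally show ?thesis by simp
  qed
qed

text \<open>Adding x x^H preserves semidefiniteness at every feasible point, so one direction of
  sufficiently negative loss rules out all optima at once.\<close>

lemma not_PE_optimal:
  assumes x: "\<forall>a<3. x a = 0"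
    and \<beta>: "\<beta> * (18 * real N * sensitivity N E y) * sqnorm (3 * (N + 1)) x
      < - Re (sform (3 * (N + 1)) (Ymat N E y) x x)"
  shows "\<not> PE_optimal N E y L Vref NU \<beta> u W z"
proof
  assume opt: "PE_optimal N E y L Vref NU \<beta> u W z"
  let ?n = "3 * (N + 1)"
  define w where "w = vec ?n x"
  have w: "w \<in> carrier_vec ?n" by (simp add: w_def)
  have w0: "\<forall>a<3. w $ a = 0" using x by (simp add: w_def)
  have psd: "hermitian_psd ?n W"
    using opt by (auto simp: PE_optimal_def PE_feasible_def)
  then have W: "W \<in> carrier_mat ?n ?n" unfolding hermitian_psd_iff by blast
  have "tr (M * (W + outer w w)) = tr (M * W) + of_real 1 * sform ?n M x x"
    if "M \<in> carrier_mat ?n ?n" for M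
  proof -
    have "sform ?n M (\<lambda>i. w $ i) (\<lambda>i. w $ i) = sform ?n M x x"
      by (rule sform_cong) (simp_all add: w_def)
    then show ?thesis
      using tr_mult_add[OF that W outer_carrier[OF w w]] tr_mult_outer[OF that w] by simp
  qed
  from PE_optimal_perturb[OF opt hermitian_psd_add[OF psd hermitian_psd_outer[OF w]]
      block_add_outer(1)[OF W w _ w0] this]
  show False using \<beta> by simp
qed

section \<open>Choice of the threshold\<close>

theorem theorem2:
  fixes N :: nat
    and E :: "(nat \<times> nat) set"
    and y :: "nat \<Rightarrow> nat \<Rightarrow> complex mat"
  assumes "1 \<le> N"
    and "tree_graph N E"
    and "line_admittances E y"
    and "\<And>j k. (j, k) \<in> E \<Longrightarrow> y j k = transpose_mat (y j k)"
    and "\<And>j k. (j, k) \<in> E \<Longrightarrow> strictly_diag_dominant (map_mat Re (y j k))"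
  shows "\<exists>\<beta>0 > 0. \<forall>(L :: limits) Vref NU.
           valid_limits N L \<longrightarrow> Vref \<in> carrier_vec 3 \<longrightarrow> Vref \<noteq> 0\<^sub>v 3 \<longrightarrow> NU \<subseteq> {1..N} \<longrightarrow>
           (\<forall>\<beta> u W z. 0 < \<beta> \<longrightarrow> \<beta> \<le> \<beta>0 \<longrightarrow> PE_optimal N E y L Vref NU \<beta> u W z \<longrightarrow>
              vec_space.rank (3 * (N + 1)) W = 1 \<and>
              (\<exists>V \<in> carrier_vec (3 * (N + 1)). W = outer V V \<and> vec 3 (\<lambda>a. V $ a) = Vref))"
proof -
  let ?n = "3 * (N + 1)"
  define K where "K = 18 * real N * sensitivity N E y"
  have K: "0 \<le> K" using sensitivity_nonneg by (simp add: K_def)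
  \<comment> \<open>The 1 in the denominator covers k = 0 and makes the inequality strict.\<close>
  have threshold: "\<beta> * k < c" if "0 \<le> k" "0 < c" "\<beta> \<le> c / (k + 1)" for \<beta> k c :: real
  proof -
    have "\<beta> * k \<le> c / (k + 1) * k" using that by (intro mult_right_mono)
    also have "\<dots> < c" using that by (simp add: field_simps)
    finally show ?thesis .
  qed
  show ?thesis
  proof (cases "\<exists>j k r. (j, k) \<in> E \<and> r < 3 \<and> Re (y j k $$ (r, r)) < 0")
    case True
    then obtain x where x: "\<forall>a<3. x a = 0" "Re (sform ?n (Ymat N E y) x x) < 0"
      using negative_conductance_form[OF assms(2,3)] by blast
    \<comment> \<open>Here x was obtained from the network alone, so this threshold does not depend
      on the data; below it the claim holds because there are no optimal solutions.\<close>
    define \<beta>0 where "\<beta>0 = - Re (sform ?n (Ymat N E y) x x) / (K * sqnorm ?n x + 1)"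
    have Kx: "0 \<le> K * sqnorm ?n x" using K by (simp add: sqnorm_def sum_nonneg)
    have "\<not> PE_optimal N E y L Vref NU \<beta> u W z" if "\<beta> \<le> \<beta>0" for L Vref NU \<beta> u W z
    proof -
      have "\<beta> * (K * sqnorm ?n x) < - Re (sform ?n (Ymat N E y) x x)"
        using Kx x(2) that by (intro threshold) (auto simp: \<beta>0_def)
      then show ?thesis
        using x(1) by (intro not_PE_optimal) (auto simp: K_def mult.assoc)
    qed
    moreover have "0 < \<beta>0" using x(2) Kx by (simp add: \<beta>0_def field_simps)
    ultimately show ?thesis by blast
  next
    case False
    then have "0 \<le> Re (y j k $$ (r, r))" if "(j, k) \<in> E" "r < 3" for j k r
      using that by force
    then obtain c where c: "c > 0"
      "\<And>x. \<forall>a<3. x a = 0 \<Longrightarrow> c * sqnorm ?n x \<le> Re (sform ?n (Ymat N E y) x x)"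
      using positive_conductance_form[OF assms(2-5)] by blast
    have "vec_space.rank ?n W = 1 \<and> (\<exists>V \<in> carrier_vec ?n. W = outer V V \<and> vec 3 (\<lambda>a. V $ a) = Vref)"
      if Vref: "Vref \<in> carrier_vec 3" "Vref \<noteq> 0\<^sub>v 3" and \<beta>: "\<beta> \<le> c / (K + 1)"
        and opt: "PE_optimal N E y L Vref NU \<beta> u W z" for L Vref NU \<beta> u W z
    proof -
      have "\<beta> * K < c" by (rule threshold[OF K c(1) \<beta>])
      then obtain V where V: "V \<in> carrier_vec ?n" "W = outer V V" "vec 3 (\<lambda>a. V $ a) = Vref"
        using PE_optimal_rank_one[OF c(2) _ Vref opt] unfolding K_def by blast
      \<comment> \<open>The slack part of V is the nonzero vector \<open>Vref\<close>.\<close>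
      have "V \<noteq> 0\<^sub>v ?n"
        using V(3) Vref(2) by (auto simp: zero_vec_def)
      then show ?thesis using rank_outer[OF V(1)] V by blast
    qed
    moreover have "0 < c / (K + 1)" using c(1) K by simp
    ultimately show ?thesis by blast
  qed
qed

end
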